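(* Let $T$ be an orientation preserving circle homeomorphism with irrational rotation number $\rho$ of bounded type and with a single break point $x_0:=x_b\in S^1$ with jump ratio $c_T(x_b)\neq1$, such that $T\in C^1([x_b,x_b+1])$ and $\mathrm{var}_{[x_b,x_b+1]}\ln T'<\infty$. Then there exists a universal constant $0<K_1<1$ such that the following holds. For every point $z_0\in S^1$ whose orbit $\mathbb O_T(z_0)$ is disjoint from that of $x_0$, there exists a subsequence of integers $\{n_m,\ m=1,2,\dots\}$ such that, for all $m$ and all $0\le k<q_{n_m+1}$, with $z_k:=T^k(z_0)$, the length of each of the two connected components of $I^{(n_m)}(z_k)\setminus\{z_k\}$ is at least $K_1|I^{(n_m)}(z_k)|$ (in other words, the barycentric coefficient of $z_k$ in $I^{(n_m)}(z_k)$ is universally bounded in $(0,1)$).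
   Context: $S^1=\mathbb R/\mathbb Z$. $|I|$ is the length of the interval $I$. The jump ratio is $c_T(x_b)=\sqrt{T'(x_b-)/T'(x_b+)}$. An irrational $\rho=[k_1,k_2,\dots]=1/(k_1+1/(k_2+\cdots))$ is of bounded type if the $k_i$ are bounded. Put $q_0=1$, $q_1=k_1$, $q_{n+1}=k_{n+1}q_n+q_{n-1}$. Dynamical partition: $I_0^{(n)}(x_0)$ is the closed arc with endpoints $x_0$ and $T^{q_n}(x_0)$, lying to the right of $x_0$ for $n$ even and to the left for $n$ odd; $I_i^{(n)}(x_0)=T^i(I_0^{(n)}(x_0))$; and $P_n(T,x_0)=\{I_i^{(n)}(x_0):0\le i<q_{n+1}\}\cup\{I_j^{(n+1)}(x_0):0\le j<q_n\}$. $I^{(n)}(z)$ denotes the interval of $P_n(T,x_0)$ containing $z$. The barycentric coefficient of $c\in[a,b]$ in $[a,b]$ is $|[a,c]|/|[a,b]|$. "Universal" means: a constant not depending on $n$ and on the point of $S^1$ under consideration. $\mathbb O_T(y)=\{T^i(y):i\in\mathbb Z\}$. *)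

theory Defs
  imports "HOL-Analysis.Analysis"
begin

quotient_type circle = real / "\<lambda>x y :: real. x - y \<in> \<int>"
  morphisms rep_circle circle_of
proof (rule equivpI)
  show "reflp (\<lambda>x y :: real. x - y \<in> \<int>)"
    by (simp add: reflp_def)
  show "symp (\<lambda>x y :: real. x - y \<in> \<int>)"
    by (metis (no_types, lifting) Ints_minus minus_diff_eq sympI)
  show "transp (\<lambda>x y :: real. x - y \<in> \<int>)"
  proof (rule transpI)
    fix x y z :: real
    assume "x - y \<in> \<int>" "y - z \<in> \<int>"
    then have "(x - y) + (y - z) \<in> \<int>" by (rule Ints_add)
    then show "x - z \<in> \<int>" by simp
  qed
qed

lemma circle_of_eq_iff: "circle_of x = circle_of y \<longleftrightarrow> x - y \<in> \<int>"
  by (rule circle.abs_eq_iff)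

instantiation circle :: topological_space
begin

definition open_circle :: "circle set \<Rightarrow> bool" where
  "open_circle U \<longleftrightarrow> open (circle_of -` U)"

instance
proof
  show "open (UNIV :: circle set)"
    by (simp add: open_circle_def)
  show "open (S \<inter> U)" if "open S" "open U" for S U :: "circle set"
    using that by (simp add: open_circle_def vimage_Int open_Int)
  show "open (\<Union> \<K>)" if "\<forall>S\<in>\<K>. open S" for \<K> :: "circle set set"
    using that by (auto simp: open_circle_def vimage_Union)
qed

end

text \<open>
  The closed arc running in the positive direction from \<open>x\<close> to \<open>y\<close>; it is \<open>{x}\<close> if \<open>x = y\<close>.
\<close>

definition right_arc :: "circle \<Rightarrow> circle \<Rightarrow> circle set" where
  "right_arc x y = \<Union> {circle_of ` {a..b} | a b.
     circle_of a = x \<and> circle_of b = y \<and> a \<le> b \<and> b < a + 1}"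

definition arc_length :: "circle set \<Rightarrow> real" where
  "arc_length A = measure lborel ({0..<1} \<inter> circle_of -` A)"

definition is_lift :: "(circle \<Rightarrow> circle) \<Rightarrow> (real \<Rightarrow> real) \<Rightarrow> bool" where
  "is_lift T F \<longleftrightarrow> continuous_on UNIV F \<and> strict_mono F \<and>
     (\<forall>x. F (x + 1) = F x + 1) \<and> (\<forall>x. circle_of (F x) = T (circle_of x))"

definition orientation_preserving_homeo :: "(circle \<Rightarrow> circle) \<Rightarrow> bool" where
  "orientation_preserving_homeo T \<longleftrightarrow>
     (\<exists>S. homeomorphism UNIV UNIV T S) \<and> (\<exists>F. is_lift T F)"

text \<open>
  Two lifts of \<open>T\<close> differ by an integer constant, so nothing below depends on the choice made here.
\<close>

definition lift :: "(circle \<Rightarrow> circle) \<Rightarrow> real \<Rightarrow> real" where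
  "lift T = (SOME F. is_lift T F)"

definition rotation_number :: "(circle \<Rightarrow> circle) \<Rightarrow> real" where
  "rotation_number T = frac (lim (\<lambda>n. (lift T ^^ n) 0 / real n))"

definition iterate :: "(circle \<Rightarrow> circle) \<Rightarrow> int \<Rightarrow> circle \<Rightarrow> circle" where
  "iterate T i = (if 0 \<le> i then T ^^ nat i else (inv T) ^^ nat (- i))"

definition full_orbit :: "(circle \<Rightarrow> circle) \<Rightarrow> circle \<Rightarrow> circle set" where
  "full_orbit T y = range (\<lambda>i. iterate T i y)"

text \<open>
  A representative \<open>b\<close> of the break point is used, and \<open>T\<close> is read on \<open>[b, b + 1]\<close> through its lift.
  The derivatives at the two end points of \<open>[b, b + 1]\<close> are one-sided.
\<close>

definition deriv_on_period :: "(circle \<Rightarrow> circle) \<Rightarrow> real \<Rightarrow> real \<Rightarrow> real" where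
  "deriv_on_period T b x = vector_derivative (lift T) (at x within {b..b + 1})"

definition C1_on_period :: "(circle \<Rightarrow> circle) \<Rightarrow> real \<Rightarrow> bool" where
  "C1_on_period T b \<longleftrightarrow>
     lift T differentiable_on {b..b + 1} \<and> continuous_on {b..b + 1} (deriv_on_period T b)"

definition jump_ratio :: "(circle \<Rightarrow> circle) \<Rightarrow> real \<Rightarrow> real" where
  "jump_ratio T b =
     sqrt (vector_derivative (lift T) (at_left b) / vector_derivative (lift T) (at_right b))"

definition total_variation :: "real \<Rightarrow> real \<Rightarrow> (real \<Rightarrow> real) \<Rightarrow> ereal" where
  "total_variation a b g =
     (SUP (n, t) \<in> {(n :: nat, t :: nat \<Rightarrow> real). mono_on {0..n} t \<and> t 0 = a \<and> t n = b}.
        ereal (\<Sum>i<n. \<bar>g (t (Suc i)) - g (t i)\<bar>))"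

text \<open>Partial quotients are indexed from 1; the value at 0 of a sequence of them is never used.\<close>

fun finite_cf :: "nat list \<Rightarrow> real" where
  "finite_cf [] = 0"
| "finite_cf (a # as) = 1 / (real a + finite_cf as)"

definition has_cf_expansion :: "real \<Rightarrow> (nat \<Rightarrow> nat) \<Rightarrow> bool" where
  "has_cf_expansion \<rho> k \<longleftrightarrow> (\<forall>i\<ge>1. 1 \<le> k i) \<and>
     (\<lambda>n. finite_cf (map k [1..<Suc n])) \<longlonglongrightarrow> \<rho>"

fun cf_denom :: "(nat \<Rightarrow> nat) \<Rightarrow> nat \<Rightarrow> nat" where
  "cf_denom k 0 = 1"
| "cf_denom k (Suc 0) = k 1"
| "cf_denom k (Suc (Suc n)) = k (Suc (Suc n)) * cf_denom k (Suc n) + cf_denom k n"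

definition base_interval ::
  "(circle \<Rightarrow> circle) \<Rightarrow> (nat \<Rightarrow> nat) \<Rightarrow> circle \<Rightarrow> nat \<Rightarrow> circle set" where
  "base_interval T q x0 n =
     (if even n then right_arc x0 ((T ^^ q n) x0) else right_arc ((T ^^ q n) x0) x0)"

definition dyn_partition ::
  "(circle \<Rightarrow> circle) \<Rightarrow> (nat \<Rightarrow> nat) \<Rightarrow> circle \<Rightarrow> nat \<Rightarrow> circle set set" where
  "dyn_partition T q x0 n =
     {(T ^^ i) ` base_interval T q x0 n | i. i < q (n + 1)} \<union>
     {(T ^^ j) ` base_interval T q x0 (n + 1) | j. j < q n}"

text \<open>Elements of the partition share end points, so this is meaningful off the orbit of \<open>x0\<close>.\<close>

definition partition_interval ::
  "(circle \<Rightarrow> circle) \<Rightarrow> (nat \<Rightarrow> nat) \<Rightarrow> circle \<Rightarrow> nat \<Rightarrow> circle \<Rightarrow> circle set" where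
  "partition_interval T q x0 n z = (THE J. J \<in> dyn_partition T q x0 n \<and> z \<in> J)"

end

theory Submission
  imports Defs
begin

text \<open>
  Let \<open>F\<close> be a lift of \<open>T\<close>. Denjoy's inequality for \<open>T ^^ q n\<close> and bounded type show that, at any
  point, the step of \<open>T ^^ q n\<close> is at most a universal multiple of the step of \<open>T ^^ q (n + 8)\<close>. Call
  an even level \<open>n\<close> good if no \<open>T ^^ j\<close> of \<open>z0\<close> with \<open>j < q (n + 1)\<close> is within one step of
  \<open>T ^^ q (n + 8)\<close> of an end point of the partition of level \<open>n\<close>; at good levels the required
  proportions hold. The orbit points involved at levels \<open>n\<close> and \<open>n + 2\<close> are so far apart that
  if both levels are bad, then \<open>z0\<close> is close to the same point of the orbit of \<open>x0\<close>
  at both of them. Hence, if all large even levels were bad, \<open>z0\<close> would lie on that orbit,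
  because the steps tend to zero. Working with even levels only avoids mirror-image cases.
\<close>

section \<open>Continued fractions\<close>

text \<open>Iterates of \<open>F\<close> have break points along the backward orbit of
  \<open>b\<close>, so no iterate is differentiated. The argument compares chord slopes, and the
  jump of \<open>ln F'\<close> enters only as one more contribution to the variation
  \<open>V\<close> over a period. Denjoy's estimate is accordingly a bound
  \<open>E = exp (5 * V)\<close> for the ratio of two successive steps. Bounded type lets
  \<open>K = (M + 1) ^ 8\<close> steps of level \<open>n + 8\<close> cover a step of level
  \<open>n\<close>, which gives \<open>C = K * E ^ K\<close>; this depends on \<open>V\<close> and
  \<open>M\<close> only, while \<open>z0\<close> influences nothing but the choice of levels. The
  offset 8 is dictated by best approximation. Two orbit points of \<open>b\<close> that are close to
  one point at level \<open>n + 8\<close> have rotation positions less than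
  \<open>2 * gap (n + 8) <= gap (n + 6)\<close> apart, and the times that occur at levels
  \<open>n\<close> and \<open>n + 2\<close> differ by less than \<open>q (n + 7)\<close>; together
  this leaves only coincidence.\<close>

primrec cf_tail :: "real \<Rightarrow> (nat \<Rightarrow> nat) \<Rightarrow> nat \<Rightarrow> real" where
  "cf_tail \<rho> k 0 = \<rho>"
| "cf_tail \<rho> k (Suc n) = 1 / cf_tail \<rho> k n - real (k (Suc n))"

lemma finite_cf_bounds:
  assumes "\<forall>a\<in>set as. 1 \<le> a"
  shows "0 \<le> finite_cf as \<and> finite_cf as \<le> 1"
  using assms by (induction as) (auto simp: field_simps)

lemma has_cf_expansion_bounds:
  assumes "has_cf_expansion \<rho> k" "\<rho> \<notin> \<rat>"
  shows "0 < \<rho>" "\<rho> < 1"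
proof -
  have lim: "(\<lambda>n. finite_cf (map k [1..<Suc n])) \<longlonglongrightarrow> \<rho>" and k: "\<forall>i\<ge>1. 1 \<le> k i"
    using assms(1) by (auto simp: has_cf_expansion_def)
  have bd: "0 \<le> finite_cf (map k [1..<Suc n]) \<and> finite_cf (map k [1..<Suc n]) \<le> 1" for n
    using k by (intro finite_cf_bounds) auto
  have "0 \<le> \<rho>" using bd by (intro LIMSEQ_le_const[OF lim]) auto
  moreover have "\<rho> \<le> 1" using bd by (intro LIMSEQ_le_const2[OF lim]) auto
  moreover have "\<rho> \<noteq> 0" "\<rho> \<noteq> 1" using assms(2) by auto
  ultimately show "0 < \<rho>" "\<rho> < 1" by auto
qed

lemma has_cf_expansion_tail:
  assumes "has_cf_expansion \<rho> k" "\<rho> \<notin> \<rat>"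
  shows "has_cf_expansion (1 / \<rho> - real (k 1)) (\<lambda>i. k (Suc i))" "1 / \<rho> - real (k 1) \<notin> \<rat>"
proof -
  have lim: "(\<lambda>n. finite_cf (map k [1..<Suc n])) \<longlonglongrightarrow> \<rho>" and k: "\<forall>i\<ge>1. 1 \<le> k i"
    using assms(1) by (auto simp: has_cf_expansion_def)
  have pos: "0 < \<rho>" using has_cf_expansion_bounds[OF assms] by auto
  have step: "finite_cf (map k [1..<Suc (Suc n)]) =
      1 / (real (k 1) + finite_cf (map (\<lambda>i. k (Suc i)) [1..<Suc n]))" for n
  proof -
    have "[1..<Suc (Suc n)] = 1 # map Suc [1..<Suc n]"
      by (subst map_Suc_upt) (simp add: upt_conv_Cons)
    then have "map k [1..<Suc (Suc n)] = k 1 # map (\<lambda>i. k (Suc i)) [1..<Suc n]"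
      by (simp only: list.map map_map o_def)
    then show ?thesis by (simp only: finite_cf.simps)
  qed
  have "(\<lambda>n. finite_cf (map k [1..<Suc (Suc n)])) \<longlonglongrightarrow> \<rho>"
    using lim by (rule LIMSEQ_Suc)
  then have "(\<lambda>n. 1 / finite_cf (map k [1..<Suc (Suc n)]) - real (k 1)) \<longlonglongrightarrow> 1 / \<rho> - real (k 1)"
    using pos by (intro tendsto_intros) auto
  then have "(\<lambda>n. finite_cf (map (\<lambda>i. k (Suc i)) [1..<Suc n])) \<longlonglongrightarrow> 1 / \<rho> - real (k 1)"
    unfolding step by simp
  then show "has_cf_expansion (1 / \<rho> - real (k 1)) (\<lambda>i. k (Suc i))"
    using k by (auto simp: has_cf_expansion_def)
  show "1 / \<rho> - real (k 1) \<notin> \<rat>"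
  proof
    assume "1 / \<rho> - real (k 1) \<in> \<rat>"
    then have "1 / \<rho> - real (k 1) + real (k 1) \<in> \<rat>" by (intro Rats_add) auto
    then have "1 / \<rho> \<in> \<rat>" by simp
    then have "1 / (1 / \<rho>) \<in> \<rat>" by (rule Rats_divide[OF Rats_1])
    moreover have "1 / (1 / \<rho>) = \<rho>" by simp
    ultimately show False using assms(2) by metis
  qed
qed

text \<open>The tails form the orbit of \<open>\<rho>\<close> under the Gauss map: each step drops
  one partial quotient and preserves irrationality.\<close>

lemma cf_tail_props:
  assumes "has_cf_expansion \<rho> k" "\<rho> \<notin> \<rat>"
  shows "has_cf_expansion (cf_tail \<rho> k n) (\<lambda>i. k (i + n)) \<and> cf_tail \<rho> k n \<notin> \<rat>"
proof (induction n)
  case 0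
  then show ?case using assms by simp
next
  case (Suc n)
  then show ?case
    using has_cf_expansion_tail[of "cf_tail \<rho> k n" "\<lambda>i. k (i + n)"] by simp
qed

lemma cf_tail_bounds:
  assumes "has_cf_expansion \<rho> k" "\<rho> \<notin> \<rat>"
  shows "0 < cf_tail \<rho> k n" "cf_tail \<rho> k n < 1"
  using cf_tail_props[OF assms, of n] has_cf_expansion_bounds by blast+

text \<open>Numerators of the convergents of \<open>\<rho> + c\<close>. The integer \<open>c\<close>
  allows for lifts whose translation number agrees with \<open>\<rho>\<close> only modulo 1.\<close>

fun cf_num :: "int \<Rightarrow> (nat \<Rightarrow> nat) \<Rightarrow> nat \<Rightarrow> int" where
  "cf_num c k 0 = c"
| "cf_num c k (Suc 0) = 1 + int (k 1) * c"
| "cf_num c k (Suc (Suc n)) = int (k (Suc (Suc n))) * cf_num c k (Suc n) + cf_num c k n"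

text \<open>This is the approximation error of the convergent of order \<open>n\<close>, without its
  sign (\<open>cf_gap_eq\<close>). As a product of numbers in (0, 1) it is visibly positive and
  decreasing.\<close>

definition cf_gap :: "real \<Rightarrow> (nat \<Rightarrow> nat) \<Rightarrow> nat \<Rightarrow> real" where
  "cf_gap \<rho> k n = (\<Prod>i\<le>n. cf_tail \<rho> k i)"

section \<open>Errors and denominators of the convergents\<close>

context
  fixes \<rho> :: real and k :: "nat \<Rightarrow> nat"
  assumes cf: "has_cf_expansion \<rho> k" and irr: "\<rho> \<notin> \<rat>"
begin

lemma cf_gap_pos: "0 < cf_gap \<rho> k n"
  unfolding cf_gap_def using cf_tail_bounds[OF cf irr] by (intro prod_pos) auto

lemma cf_gap_Suc: "cf_gap \<rho> k (Suc n) = cf_gap \<rho> k n * cf_tail \<rho> k (Suc n)"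
  by (simp add: cf_gap_def del: cf_tail.simps)

lemma cf_gap_Suc_less: "cf_gap \<rho> k (Suc n) < cf_gap \<rho> k n"
  using cf_gap_pos[of n] cf_tail_bounds[OF cf irr, of "Suc n"]
  by (simp add: cf_gap_Suc del: cf_tail.simps)

lemma cf_gap_rec:
  "cf_gap \<rho> k n = real (k (Suc (Suc n))) * cf_gap \<rho> k (Suc n) + cf_gap \<rho> k (Suc (Suc n))"
proof -
  have "cf_tail \<rho> k (Suc n) > 0" by (rule cf_tail_bounds[OF cf irr])
  moreover have "cf_tail \<rho> k (Suc (Suc n)) = 1 / cf_tail \<rho> k (Suc n) - real (k (Suc (Suc n)))"
    by simp
  ultimately have 1: "cf_tail \<rho> k (Suc n) * (real (k (Suc (Suc n))) + cf_tail \<rho> k (Suc (Suc n))) = 1"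
    by (simp del: cf_tail.simps)
  show ?thesis
    using arg_cong[OF 1, of "\<lambda>x. cf_gap \<rho> k n * x"]
    unfolding cf_gap_Suc by (simp add: algebra_simps del: cf_tail.simps)
qed

lemma k_ge_1: "1 \<le> i \<Longrightarrow> 1 \<le> k i"
  using cf by (auto simp: has_cf_expansion_def)

lemma cf_gap_halves: "2 * cf_gap \<rho> k (Suc (Suc n)) \<le> cf_gap \<rho> k n"
proof -
  have "1 * cf_gap \<rho> k (Suc n) \<le> real (k (Suc (Suc n))) * cf_gap \<rho> k (Suc n)"
    using k_ge_1[of "Suc (Suc n)"] cf_gap_pos[of "Suc n"] by (intro mult_right_mono) auto
  then show ?thesis
    using cf_gap_rec[of n] cf_gap_Suc_less[of "Suc n"] by simp
qed

lemma cf_gap_le_Suc: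
  assumes "k (Suc (Suc n)) \<le> M"
  shows "cf_gap \<rho> k n \<le> (real M + 1) * cf_gap \<rho> k (Suc n)"
proof -
  have "real (k (Suc (Suc n))) * cf_gap \<rho> k (Suc n) \<le> real M * cf_gap \<rho> k (Suc n)"
    using assms cf_gap_pos[of "Suc n"] by (intro mult_right_mono) auto
  then show ?thesis
    using cf_gap_rec[of n] cf_gap_Suc_less[of "Suc n"] by (simp add: algebra_simps)
qed

lemma cf_gap_le_power:
  assumes "\<forall>i\<ge>1. k i \<le> M"
  shows "cf_gap \<rho> k n \<le> (real M + 1) ^ s * cf_gap \<rho> k (n + s)"
proof (induction s)
  case (Suc s)
  have "cf_gap \<rho> k (n + s) \<le> (real M + 1) * cf_gap \<rho> k (Suc (n + s))"
    using assms by (intro cf_gap_le_Suc) auto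
  then have "(real M + 1) ^ s * cf_gap \<rho> k (n + s)
      \<le> (real M + 1) ^ s * ((real M + 1) * cf_gap \<rho> k (Suc (n + s)))"
    by (intro mult_left_mono) auto
  with Suc have "cf_gap \<rho> k n \<le> (real M + 1) ^ s * ((real M + 1) * cf_gap \<rho> k (Suc (n + s)))"
    by linarith
  then show ?case by (simp add: mult_ac)
qed simp

lemma cf_gap_eq:
  "real (cf_denom k n) * (\<rho> + of_int c) - of_int (cf_num c k n) = (- 1) ^ n * cf_gap \<rho> k n"
proof -
  have "\<rho> > 0" using has_cf_expansion_bounds[OF cf irr] by simp
  have "real (cf_denom k n) * (\<rho> + of_int c) - of_int (cf_num c k n) = (- 1) ^ n * cf_gap \<rho> k n \<and>
    real (cf_denom k (Suc n)) * (\<rho> + of_int c) - of_int (cf_num c k (Suc n))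
      = (- 1) ^ Suc n * cf_gap \<rho> k (Suc n)"
  proof (induction n)
    case 0
    then show ?case using \<open>\<rho> > 0\<close> by (simp add: cf_gap_def field_simps)
  next
    case (Suc n)
    have "real (cf_denom k (Suc (Suc n))) * (\<rho> + of_int c) - of_int (cf_num c k (Suc (Suc n)))
      = real (k (Suc (Suc n))) * (real (cf_denom k (Suc n)) * (\<rho> + of_int c) - of_int (cf_num c k (Suc n)))
       + (real (cf_denom k n) * (\<rho> + of_int c) - of_int (cf_num c k n))"
      by (simp add: algebra_simps)
    also have "\<dots> = (- 1) ^ Suc (Suc n) * cf_gap \<rho> k (Suc (Suc n))"
      unfolding conjunct1[OF Suc] conjunct2[OF Suc] cf_gap_rec[of n] by (simp add: algebra_simps)
    finally show ?case using Suc by blast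
  qed
  then show ?thesis by blast
qed

lemma cf_denom_pos_le: "0 < cf_denom k n \<and> cf_denom k n \<le> cf_denom k (Suc n)"
proof (induction n)
  case 0
  then show ?case using k_ge_1[of 1] by simp
next
  case (Suc n)
  have "1 * cf_denom k (Suc n) \<le> k (Suc (Suc n)) * cf_denom k (Suc n)"
    using k_ge_1[of "Suc (Suc n)"] by (intro mult_right_mono) auto
  then show ?case using Suc unfolding cf_denom.simps by linarith
qed

lemma cf_denom_double: "2 * cf_denom k n \<le> cf_denom k (Suc (Suc n))"
proof -
  have "1 * cf_denom k (Suc n) \<le> k (Suc (Suc n)) * cf_denom k (Suc n)"
    using k_ge_1[of "Suc (Suc n)"] by (intro mult_right_mono) auto
  then show ?thesis using cf_denom_pos_le[of n] unfolding cf_denom.simps by linarith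
qed

end

section \<open>Farey pairs and return times of a rotation\<close>

lemma cf_unimodular:
  "int (cf_denom k (Suc n)) * cf_num c k n - int (cf_denom k n) * cf_num c k (Suc n) = (- 1) ^ Suc n"
proof (induction n)
  case (Suc n)
  have "int (cf_denom k (Suc (Suc n))) * cf_num c k (Suc n) - int (cf_denom k (Suc n)) * cf_num c k (Suc (Suc n))
    = - (int (cf_denom k (Suc n)) * cf_num c k n - int (cf_denom k n) * cf_num c k (Suc n))"
    by (simp add: algebra_simps)
  then show ?case using Suc by simp
qed simp

text \<open>The vectors \<open>(P, - p)\<close> and \<open>(Q, - r)\<close> form a basis of the
  integer lattice. In the coordinates \<open>s\<close>, \<open>t\<close> both the time
  \<open>m\<close> and the displacement are explicit, so signs of \<open>s\<close> and
  \<open>t\<close> link the two.\<close>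

lemma cone_coordinates:
  fixes P Q p r m a :: int and \<rho> :: real
  assumes "P * r - Q * p = 1"
  obtains s t where "m = s * P + t * Q" "- a = s * p + t * r"
    "real_of_int m * \<rho> + of_int a
      = of_int s * (of_int P * \<rho> - of_int p) - of_int t * (of_int r - of_int Q * \<rho>)"
proof
  define s where "s = m * r + a * Q"
  define t where "t = - (m * p + a * P)"
  have "s * P + t * Q = m * (P * r - Q * p)" by (simp add: s_def t_def algebra_simps)
  then show 1: "m = s * P + t * Q" using assms by simp
  have "s * p + t * r = - a * (P * r - Q * p)" by (simp add: s_def t_def algebra_simps)
  then show 2: "- a = s * p + t * r" using assms by simp
  have 3: "real_of_int a = - (of_int s * of_int p + of_int t * of_int r)"
    using arg_cong[OF 2, of real_of_int] by simp
  show "real_of_int m * \<rho> + of_int a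
      = of_int s * (of_int P * \<rho> - of_int p) - of_int t * (of_int r - of_int Q * \<rho>)"
    unfolding 1 3 by (simp add: algebra_simps)
qed

text \<open>Farey neighbours \<open>p / P < \<rho> < r / Q\<close>. No order between
  \<open>P\<close> and \<open>Q\<close> is imposed.\<close>

locale farey_pair =
  fixes P Q p r :: int and \<rho> \<alpha> \<beta> :: real
  assumes P_pos: "0 < P" and Q_pos: "0 < Q"
    and det: "P * r - Q * p = 1"
    and alpha: "\<alpha> = of_int P * \<rho> - of_int p" and beta: "\<beta> = of_int r - of_int Q * \<rho>"
    and right: "0 < \<alpha>" and left: "0 < \<beta>"
begin

text \<open>If \<open>s >= 1\<close> then \<open>t >= 1\<close>, since otherwise the displacement
  would reach \<open>\<alpha>\<close>; if \<open>s <= 0\<close> then \<open>t <= - 1\<close>, since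
  otherwise it would not be positive. Either way \<open>m\<close> is far from 0.\<close>

lemma no_return_right:
  assumes "0 < real_of_int m * \<rho> + of_int a" "real_of_int m * \<rho> + of_int a < \<alpha>"
  shows "m \<le> - Q \<or> P + Q \<le> m"
proof -
  obtain s t where st: "m = s * P + t * Q" "- a = s * p + t * r"
    "real_of_int m * \<rho> + of_int a = of_int s * \<alpha> - of_int t * \<beta>"
    by (rule cone_coordinates[OF det, of m a \<rho>, folded alpha beta])
  show ?thesis
  proof (cases "s \<ge> 1")
    case True
    have "t \<ge> 1"
    proof (rule ccontr)
      assume "\<not> t \<ge> 1"
      then have "of_int t * \<beta> \<le> 0" using left by (simp add: mult_nonpos_nonneg)
      moreover have "1 * \<alpha> \<le> of_int s * \<alpha>" using True right by (intro mult_right_mono) auto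
      ultimately show False using assms st(3) by linarith
    qed
    then have "1 * P + 1 * Q \<le> s * P + t * Q"
      using True P_pos Q_pos by (intro add_mono mult_right_mono) auto
    then show ?thesis using st by simp
  next
    case False
    then have s0: "s \<le> 0" by simp
    have "t \<le> - 1"
    proof (rule ccontr)
      assume "\<not> t \<le> - 1"
      then have "of_int t * \<beta> \<ge> 0" using left by simp
      moreover have "of_int s * \<alpha> \<le> 0" using s0 right by (simp add: mult_nonpos_nonneg)
      ultimately show False using assms st(3) by linarith
    qed
    then have "s * P + t * Q \<le> 0 * P + (- 1) * Q"
      using s0 P_pos Q_pos by (intro add_mono mult_right_mono) auto
    then show ?thesis using st by simp
  qed
qed

lemma no_return_left:
  assumes "0 < real_of_int m * \<rho> + of_int a" "real_of_int m * \<rho> + of_int a < \<beta>"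
  shows "m \<le> - (P + Q) \<or> P \<le> m"
proof -
  obtain s t where st: "m = s * P + t * Q" "- a = s * p + t * r"
    "real_of_int m * \<rho> + of_int a = of_int s * \<alpha> - of_int t * \<beta>"
    by (rule cone_coordinates[OF det, of m a \<rho>, folded alpha beta])
  show ?thesis
  proof (cases "t \<ge> 0")
    case True
    have "s \<ge> 1"
    proof (rule ccontr)
      assume "\<not> s \<ge> 1"
      then have "of_int s * \<alpha> \<le> 0" using right by (simp add: mult_nonpos_nonneg)
      moreover have "of_int t * \<beta> \<ge> 0" using True left by simp
      ultimately show False using assms st(3) by linarith
    qed
    then have "1 * P + 0 * Q \<le> s * P + t * Q"
      using True P_pos Q_pos by (intro add_mono mult_right_mono) auto
    then show ?thesis using st by simp
  next
    case False
    then have t1: "t \<le> - 1" by simp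
    have "s \<le> - 1"
    proof (rule ccontr)
      assume "\<not> s \<le> - 1"
      then have "of_int s * \<alpha> \<ge> 0" using right by simp
      moreover have "of_int t * \<beta> \<le> (- 1) * \<beta>" using t1 left by (intro mult_right_mono) auto
      ultimately show False using assms st(3) by linarith
    qed
    then have "s * P + t * Q \<le> (- 1) * P + (- 1) * Q"
      using t1 P_pos Q_pos by (intro add_mono mult_right_mono) auto
    then show ?thesis using st by simp
  qed
qed

text \<open>A nonzero displacement is excluded by \<open>no_return_right\<close> for
  \<open>m\<close> or \<open>- m\<close>. Displacement zero forces \<open>s\<close> and
  \<open>t\<close> to have the same sign, and then \<open>m\<close> is too large unless both
  vanish.\<close>

lemma best_approximation:
  assumes "\<bar>real_of_int m * \<rho> + of_int a\<bar> < \<alpha>" "\<bar>m\<bar> < Q"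
  shows "m = 0 \<and> a = 0"
proof -
  have "\<not> 0 < real_of_int m * \<rho> + of_int a"
    using no_return_right[of m a] assms P_pos by auto
  moreover have "\<not> 0 < real_of_int (- m) * \<rho> + of_int (- a)"
    using no_return_right[of "- m" "- a"] assms P_pos by auto
  ultimately have 0: "real_of_int m * \<rho> + of_int a = 0" by simp
  obtain s t where st: "m = s * P + t * Q" "- a = s * p + t * r"
    "real_of_int m * \<rho> + of_int a = of_int s * \<alpha> - of_int t * \<beta>"
    by (rule cone_coordinates[OF det, of m a \<rho>, folded alpha beta])
  have eq: "of_int s * \<alpha> = of_int t * \<beta>" using 0 st by simp
  have "t = 0"
  proof (rule ccontr)
    assume "t \<noteq> 0"
    then consider "t \<ge> 1" | "t \<le> - 1" by linarith
    then show False
    proof cases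
      case 1
      then have "of_int s * \<alpha> > 0" unfolding eq using left by simp
      then have "s \<ge> 1" using right by (simp add: zero_less_mult_iff)
      then have "1 * P + 1 * Q \<le> s * P + t * Q"
        using 1 P_pos Q_pos by (intro add_mono mult_right_mono) auto
      then show False using st assms(2) P_pos by simp
    next
      case 2
      then have "of_int s * \<alpha> < 0" unfolding eq using left by (simp add: mult_neg_pos)
      then have "s \<le> - 1" using right by (simp add: mult_less_0_iff)
      then have "s * P + t * Q \<le> (- 1) * P + (- 1) * Q"
        using 2 P_pos Q_pos by (intro add_mono mult_right_mono) auto
      then show False using st assms(2) P_pos by simp
    qed
  qed
  then show ?thesis using eq right st by simp
qed

end

section \<open>Lifts of circle homeomorphisms\<close>

locale circle_lift =
  fixes F :: "real \<Rightarrow> real"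
  assumes mono: "strict_mono F" and cont: "continuous_on UNIV F" and per: "F (x + 1) = F x + 1"
begin

lemma add_int: "F (x + of_int n) = F x + of_int n"
proof -
  have nat: "F (y + real m) = F y + real m" for y m
    by (induction m) (use per in \<open>auto simp: add.assoc[symmetric] add.commute[of 1]\<close>)
  show ?thesis
  proof (cases "n \<ge> 0")
    case True
    then show ?thesis using nat[of x "nat n"] by simp
  next
    case False
    then show ?thesis using nat[of "x + of_int n" "nat (- n)"] by simp
  qed
qed

lemma less_iff [simp]: "F x < F y \<longleftrightarrow> x < y"
  using mono by (simp add: strict_mono_less)

lemma le_iff [simp]: "F x \<le> F y \<longleftrightarrow> x \<le> y"
  using mono by (simp add: strict_mono_less_eq)

lemma displacement: "\<bar>(F x - x) - (F y - y)\<bar> \<le> 1"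
proof -
  have *: "(F x - x) - (F y - y) \<le> 1" for x y
  proof -
    define n where "n = \<lfloor>x - y\<rfloor>"
    have n: "of_int n \<le> x - y" "x - y < of_int n + 1" unfolding n_def by linarith+
    then have "F x \<le> F (y + of_int (n + 1))" by simp
    also have "\<dots> = F y + of_int (n + 1)" by (rule add_int)
    finally show ?thesis using n by simp
  qed
  from *[of x y] *[of y x] show ?thesis by linarith
qed

lemma bij: "bij F"
proof (rule bijI)
  show "inj F" using mono by (rule strict_mono_imp_inj_on)
  show "surj F"
  proof (rule surjI)
    fix y :: real
    define n where "n = \<lfloor>y - F 0\<rfloor>"
    have "F (of_int n) = F 0 + of_int n" "F (of_int (n + 1)) = F 0 + of_int (n + 1)"
      using add_int[of 0 n] add_int[of 0 "n + 1"] by auto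
    moreover have "of_int n \<le> y - F 0" "y - F 0 \<le> of_int (n + 1)" unfolding n_def by linarith+
    ultimately have "F (of_int n) \<le> y" "y \<le> F (of_int (n + 1))" by linarith+
    moreover have "continuous_on {of_int n..of_int (n + 1)} F"
      using cont continuous_on_subset by blast
    ultimately have "\<exists>x. F x = y" using IVT'[of F "of_int n" y "of_int (n + 1)"] by auto
    then show "F (SOME x. F x = y) = y" by (rule someI_ex)
  qed
qed

lemma image_Icc: "F ` {x..y} = {F x..F y}"
proof
  show "{F x..F y} \<subseteq> F ` {x..y}"
  proof
    fix z assume z: "z \<in> {F x..F y}"
    obtain w where "z = F w" using bij by (metis bij_pointE)
    then show "z \<in> F ` {x..y}" using z by auto
  qed
qed auto

lemma circle_lift_funpow: "circle_lift (F ^^ n)"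
proof
  show "strict_mono (F ^^ n)"
    by (induction n) (use mono in \<open>auto simp: strict_mono_def\<close>)
  show "continuous_on UNIV (F ^^ n)"
  proof (induction n)
    case (Suc n)
    then show ?case using cont by (auto intro: continuous_on_compose2)
  qed (auto intro: continuous_on_id)
  show "(F ^^ n) (x + 1) = (F ^^ n) x + 1" for x
    by (induction n) (use per in auto)
qed

lemmas iter_add_int = circle_lift.add_int[OF circle_lift_funpow]
lemmas iter_less_iff [simp] = circle_lift.less_iff[OF circle_lift_funpow]
lemmas iter_le_iff [simp] = circle_lift.le_iff[OF circle_lift_funpow]

lemma iter_iter: "(F ^^ m) ((F ^^ n) x) = (F ^^ (m + n)) x"
  by (simp add: funpow_add)

text \<open>Displacements of one iterate differ by at most 1 from point to point, so
  \<open>a\<close> is additive up to a bounded error. The final 2 is 1 for replacing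
  \<open>x\<close> by 0 and 1 for the distance of \<open>a n\<close> from
  \<open>n * L\<close>.\<close>

lemma translation_number:
  obtains L where "(\<lambda>n. (F ^^ n) 0 / real n) \<longlonglongrightarrow> L"
    "\<And>n x. \<bar>(F ^^ n) x - x - real n * L\<bar> \<le> 2"
proof -
  define a where "a = (\<lambda>n. (F ^^ n) 0)"
  have disp: "\<bar>(F ^^ n) x - x - a n\<bar> \<le> 1" for n x
    using circle_lift.displacement[OF circle_lift_funpow, of n x 0] by (simp add: a_def)
  have mult: "\<bar>a (m * n) - real m * a n\<bar> \<le> real m" for m n
  proof (induction m)
    case (Suc m)
    have "a (Suc m * n) = (F ^^ n) (a (m * n))" by (simp add: a_def iter_iter)
    then have "\<bar>a (Suc m * n) - a (m * n) - a n\<bar> \<le> 1" using disp[of n "a (m * n)"] by simp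
    then show ?case using Suc by (simp add: algebra_simps abs_le_iff)
  qed (simp add: a_def)
  have quot: "\<bar>a (m * n) / real (m * n) - a n / real n\<bar> \<le> 1 / real n" if "m > 0" "n > 0" for m n
  proof -
    have "a (m * n) / real (m * n) - a n / real n = (a (m * n) - real m * a n) / (real m * real n)"
      using that by (simp add: field_simps)
    also have "\<bar>\<dots>\<bar> \<le> real m / (real m * real n)"
      using mult[of m n] that unfolding abs_divide by (intro frac_le) auto
    finally show ?thesis using that by simp
  qed
  have diff: "\<bar>a n / real n - a m / real m\<bar> \<le> 1 / real n + 1 / real m" if "m > 0" "n > 0" for m n
    using quot[of m n] quot[of n m] that unfolding mult.commute[of n m] by linarith
  have "Cauchy (\<lambda>n. a n / real n)"
  proof (rule metric_CauchyI)
    fix e :: real assume "e > 0"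
    then obtain N where N: "N > 0" "1 / real N < e / 2"
      using real_arch_inverse[of "e / 2"] by (auto simp: inverse_eq_divide)
    have "dist (a m / real m) (a n / real n) < e" if "m \<ge> N" "n \<ge> N" for m n
    proof -
      have "1 / real m \<le> 1 / real N" "1 / real n \<le> 1 / real N"
        using that N by (auto intro!: divide_left_mono)
      then show ?thesis using diff[of n m] that N by (simp add: dist_real_def)
    qed
    then show "\<exists>M. \<forall>m\<ge>M. \<forall>n\<ge>M. dist (a m / real m) (a n / real n) < e" by blast
  qed
  then obtain L where L: "(\<lambda>n. a n / real n) \<longlonglongrightarrow> L"
    using Cauchy_convergent_iff convergent_def by blast
  have La: "\<bar>a n - real n * L\<bar> \<le> 1" for n
  proof (cases "n = 0")
    case False
    have "(\<lambda>m. \<bar>a n / real n - a m / real m\<bar>) \<longlonglongrightarrow> \<bar>a n / real n - L\<bar>"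
      using L by (intro tendsto_intros)
    moreover have "(\<lambda>m. 1 / real n + 1 / real m) \<longlonglongrightarrow> 1 / real n + 0"
      by (intro tendsto_intros lim_1_over_n)
    ultimately have "\<bar>a n / real n - L\<bar> \<le> 1 / real n + 0"
      using diff[of _ n] False by (intro LIMSEQ_le) (auto intro!: exI[of _ 1])
    then have "real n * \<bar>a n / real n - L\<bar> \<le> real n * (1 / real n)"
      by (intro mult_left_mono) auto
    moreover have "real n * \<bar>a n / real n - L\<bar> = \<bar>real n * (a n / real n - L)\<bar>"
      by (simp add: abs_mult)
    ultimately show ?thesis using False by (simp add: algebra_simps)
  qed (simp add: a_def)
  show thesis
  proof
    show "(\<lambda>n. (F ^^ n) 0 / real n) \<longlonglongrightarrow> L" using L by (simp add: a_def)
    show "\<bar>(F ^^ n) x - x - real n * L\<bar> \<le> 2" for n x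
      using disp[of n x] La[of n] by linarith
  qed
qed

end

section \<open>Comparison of orbits with a rotation\<close>

locale rotating_lift = circle_lift +
  fixes \<rho> :: real
  assumes rot: "\<bar>(F ^^ n) x - x - real n * \<rho>\<bar> \<le> 2"
begin

text \<open>A point violating this would advance by at most \<open>p\<close> in every
  \<open>m\<close> iterates, so it would fall behind \<open>\<rho>\<close> by an amount growing
  linearly, against \<open>rot\<close>.\<close>

lemma above_translation:
  assumes "of_int p < real m * \<rho>"
  shows "x + of_int p < (F ^^ m) x"
proof (rule ccontr)
  assume "\<not> ?thesis"
  then have le: "(F ^^ m) x \<le> x + of_int p" by simp
  have iter: "(F ^^ (n * m)) x \<le> x + of_int (int n * p)" for n
  proof (induction n)
    case (Suc n)
    have "(F ^^ (Suc n * m)) x = (F ^^ m) ((F ^^ (n * m)) x)" by (simp add: iter_iter)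
    also have "\<dots> \<le> (F ^^ m) (x + of_int (int n * p))" using Suc by simp
    also have "\<dots> = (F ^^ m) x + of_int (int n * p)" by (rule iter_add_int)
    finally show ?case using le by (simp add: algebra_simps)
  qed simp
  have "real n * (real m * \<rho> - of_int p) \<le> 2" for n
    using iter[of n] rot[of "n * m" x] by (simp add: algebra_simps abs_le_iff)
  moreover obtain n where "2 < real n * (real m * \<rho> - of_int p)"
    using reals_Archimedean3[of "real m * \<rho> - of_int p"] assms by auto
  ultimately show False by (meson not_le)
qed

lemma below_translation:
  assumes "real m * \<rho> < of_int p"
  shows "(F ^^ m) x < x + of_int p"
proof (rule ccontr)
  assume "\<not> ?thesis"
  then have le: "x + of_int p \<le> (F ^^ m) x" by simp
  have iter: "x + of_int (int n * p) \<le> (F ^^ (n * m)) x" for n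
  proof (induction n)
    case (Suc n)
    have "(F ^^ m) x + of_int (int n * p) = (F ^^ m) (x + of_int (int n * p))"
      by (rule iter_add_int[symmetric])
    also have "\<dots> \<le> (F ^^ m) ((F ^^ (n * m)) x)" using Suc by simp
    also have "\<dots> = (F ^^ (Suc n * m)) x" by (simp add: iter_iter)
    finally show ?case using le by (simp add: algebra_simps)
  qed simp
  have "real n * (of_int p - real m * \<rho>) \<le> 2" for n
    using iter[of n] rot[of "n * m" x] by (simp add: algebra_simps abs_le_iff)
  moreover obtain n where "2 < real n * (of_int p - real m * \<rho>)"
    using reals_Archimedean3[of "of_int p - real m * \<rho>"] assms by auto
  ultimately show False by (meson not_le)
qed

text \<open>All questions about the order of an orbit and its integer translates are thereby reduced
  to integer combinations of \<open>\<rho>\<close> and 1, without a semiconjugacy.\<close>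

lemma orbit_less:
  assumes "real i * \<rho> + of_int a < real j * \<rho> + of_int c"
  shows "(F ^^ i) x + of_int a < (F ^^ j) x + of_int c"
proof (cases "i \<le> j")
  case True
  then have "of_int (a - c) < real (j - i) * \<rho>" using assms by (simp add: of_nat_diff algebra_simps)
  then have "(F ^^ i) x + of_int (a - c) < (F ^^ (j - i)) ((F ^^ i) x)" by (rule above_translation)
  then show ?thesis using True by (simp add: iter_iter)
next
  case False
  then have "real (i - j) * \<rho> < of_int (c - a)" using assms by (simp add: of_nat_diff algebra_simps)
  then have "(F ^^ (i - j)) ((F ^^ j) x) < (F ^^ j) x + of_int (c - a)" by (rule below_translation)
  then show ?thesis using False by (simp add: iter_iter)
qed

lemma orbit_le:
  assumes "(F ^^ i) x + of_int a \<le> (F ^^ j) x + of_int c"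
  shows "real i * \<rho> + of_int a \<le> real j * \<rho> + of_int c"
  using orbit_less[of j c i a x] assms by force

lemma orbit_less':
  assumes "(F ^^ i) x + of_int a < (F ^^ j) x + of_int c" "\<rho> \<notin> \<rat>"
  shows "real i * \<rho> + of_int a < real j * \<rho> + of_int c"
proof -
  have "real i * \<rho> + of_int a \<noteq> real j * \<rho> + of_int c"
  proof
    assume eq: "real i * \<rho> + of_int a = real j * \<rho> + of_int c"
    then have 1: "(real i - real j) * \<rho> = of_int (c - a)" by (simp add: algebra_simps)
    show False
    proof (cases "i = j")
      case True
      then show False using eq assms(1) by simp
    next
      case False
      then have "\<rho> = of_int (c - a) / of_int (int i - int j)" using 1 by (simp add: field_simps)
      then show False using assms(2) by (metis Rats_divide Rats_of_int)
    qed
  qed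
  then show ?thesis using orbit_le[OF less_imp_le[OF assms(1)]] by simp
qed

end

lemma left_neighbour:
  fixes f :: "nat \<Rightarrow> real"
  assumes "0 < N"
  obtains m a where "m < N" "f m + of_int a \<le> y"
    "\<And>m' a'. m' < N \<Longrightarrow> f m' + of_int a' \<le> y \<Longrightarrow> f m' + of_int a' \<le> f m + of_int a"
proof -
  define u where "u = (\<lambda>m. f m + of_int \<lfloor>y - f m\<rfloor>)"
  have "Max (u ` {..<N}) \<in> u ` {..<N}" using assms by (intro Max_in) auto
  then obtain m where m: "m \<in> {..<N}" "u m = Max (u ` {..<N})" by auto
  show thesis
  proof
    show "m < N" using m by simp
    show "f m + of_int \<lfloor>y - f m\<rfloor> \<le> y" by linarith
    fix m' a' assume *: "m' < N" "f m' + of_int a' \<le> y"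
    then have "a' \<le> \<lfloor>y - f m'\<rfloor>" by linarith
    then have "f m' + of_int a' \<le> u m'" by (simp add: u_def)
    also have "\<dots> \<le> u m" unfolding m(2) using * by (intro Max_ge) auto
    finally show "f m' + of_int a' \<le> f m + of_int \<lfloor>y - f m\<rfloor>" by (simp add: u_def)
  qed
qed

section \<open>The Denjoy inequality\<close>

text \<open>With partial sums S of \<open>w\<close>, both sides are S(P + Q) - S(P) - S(Q).\<close>

lemma sum_shift_swap:
  fixes w :: "nat \<Rightarrow> real"
  shows "(\<Sum>m<P. w (m + Q) - w m) = (\<Sum>m<Q. w (m + P) - w m)"
proof -
  have split: "(\<Sum>m<P + Q. w m) = (\<Sum>m<Q. w m) + (\<Sum>m<P. w (m + Q))" for P Q
    by (induction P) (auto simp: add_ac)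
  have "(\<Sum>m<Q. w m) + (\<Sum>m<P. w (m + Q)) = (\<Sum>m<P. w m) + (\<Sum>m<Q. w (m + P))"
    using split[of P Q] split[of Q P] by (simp only: add.commute[of Q P])
  then show ?thesis unfolding sum_subtractf by linarith
qed

text \<open>\<open>\<phi>\<close> plays the role of \<open>ln F'\<close> and \<open>W\<close> that of its cumulative variation.\<close>

locale bv_lift = circle_lift +
  fixes \<phi> W :: "real \<Rightarrow> real" and V :: real
  assumes phi_per: "\<phi> (x + 1) = \<phi> x"
    and W_per: "W (x + 1) = W x + V"
    and osc: "s \<le> t \<Longrightarrow> \<bar>\<phi> t - \<phi> s\<bar> \<le> W t - W s"
    and slope: "x < y \<Longrightarrow> \<bar>ln ((F y - F x) / (y - x)) - \<phi> x\<bar> \<le> W y - W x"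
begin

lemma W_mono: "s \<le> t \<Longrightarrow> W s \<le> W t"
  using osc[of s t] by linarith

lemma W_add_int: "W (x + of_int n) = W x + of_int n * V"
proof -
  have nat: "W (y + real m) = W y + real m * V" for y m
  proof (induction m)
    case (Suc m)
    have "W (y + real (Suc m)) = W (y + real m + 1)" by (simp only: of_nat_Suc add_ac)
    also have "\<dots> = W (y + real m) + V" by (rule W_per)
    finally show ?case using Suc by (simp add: algebra_simps)
  qed simp
  show ?thesis
  proof (cases "n \<ge> 0")
    case True
    then show ?thesis using nat[of x "nat n"] by simp
  next
    case False
    then show ?thesis using nat[of "x + of_int n" "nat (- n)"] by (simp add: algebra_simps)
  qed
qed

lemma phi_add_int: "\<phi> (x + of_int n) = \<phi> x"
proof -
  have nat: "\<phi> (y + real m) = \<phi> y" for y m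
  proof (induction m)
    case (Suc m)
    have "\<phi> (y + real (Suc m)) = \<phi> (y + real m + 1)" by (simp only: of_nat_Suc add_ac)
    also have "\<dots> = \<phi> (y + real m)" by (rule phi_per)
    finally show ?case using Suc by simp
  qed simp
  show ?thesis
  proof (cases "n \<ge> 0")
    case True
    then show ?thesis using nat[of x "nat n"] by simp
  next
    case False
    then show ?thesis using nat[of "x + of_int n" "nat (- n)"] by simp
  qed
qed

definition \<Phi> :: "nat \<Rightarrow> real \<Rightarrow> real" where
  "\<Phi> m x = (\<Sum>i<m. \<phi> ((F ^^ i) x))"

lemma Phi_add_int: "\<Phi> m (x + of_int n) = \<Phi> m x"
  by (simp add: \<Phi>_def iter_add_int phi_add_int)

lemma Phi_add: "\<Phi> (m + n) x = \<Phi> m x + \<Phi> n ((F ^^ m) x)"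
  by (induction n) (auto simp: \<Phi>_def iter_iter add.commute)

lemma slope_iter:
  assumes "x < y"
  shows "\<bar>ln (((F ^^ m) y - (F ^^ m) x) / (y - x)) - \<Phi> m x\<bar>
    \<le> (\<Sum>i<m. W ((F ^^ i) y) - W ((F ^^ i) x))"
proof (induction m)
  case (Suc m)
  define u v where "u = (F ^^ m) x" and "v = (F ^^ m) y"
  have uv: "u < v" "F u < F v" using assms by (auto simp: u_def v_def)
  have "(F v - F u) / (y - x) = ((F v - F u) / (v - u)) * ((v - u) / (y - x))"
    using uv assms by simp
  also have "ln \<dots> = ln ((F v - F u) / (v - u)) + ln ((v - u) / (y - x))"
    using uv assms by (intro ln_mult_pos divide_pos_pos) auto
  finally have "ln ((F v - F u) / (y - x)) = ln ((F v - F u) / (v - u)) + ln ((v - u) / (y - x))" .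
  then show ?case
    using slope[OF uv(1)] Suc by (simp add: \<Phi>_def flip: u_def v_def)
qed (use assms in \<open>simp add: \<Phi>_def\<close>)

lemma Phi_diff:
  assumes "x \<le> y"
  shows "\<bar>\<Phi> m y - \<Phi> m x\<bar> \<le> (\<Sum>i<m. W ((F ^^ i) y) - W ((F ^^ i) x))"
proof -
  have "\<bar>\<Phi> m y - \<Phi> m x\<bar> \<le> (\<Sum>i<m. \<bar>\<phi> ((F ^^ i) y) - \<phi> ((F ^^ i) x)\<bar>)"
    unfolding \<Phi>_def by (simp add: sum_subtractf[symmetric] sum_abs)
  also have "\<dots> \<le> (\<Sum>i<m. W ((F ^^ i) y) - W ((F ^^ i) x))"
    using assms by (intro sum_mono osc) auto
  finally show ?thesis .
qed

end

text \<open>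
  \<open>G = F\<^sup>P - p\<close> moves points to the right and \<open>F\<^sup>Q - r\<close> moves them to the left by a larger amount.
\<close>

locale denjoy_pair = bv_lift +
  fixes P Q :: nat and p r :: int
  assumes det: "int P * r - int Q * p = 1"
    and right: "x + of_int p < (F ^^ P) x"
    and left: "(F ^^ (P + Q)) x \<le> x + of_int (p + r)"
    and Q_le: "Q \<le> P" and P_pos: "0 < P"
begin

definition G :: "real \<Rightarrow> real" where "G x = (F ^^ P) x - of_int p"
definition d :: "real \<Rightarrow> real" where "d x = G x - x"

lemma d_pos: "0 < d x"
  using right[of x] by (simp add: d_def G_def)

text \<open>
  The intervals \<open>F\<^sup>m [x, y]\<close>, \<open>m < P\<close>, do not overlap modulo 1; exchanging the two summations
  replaces this combinatorial fact by monotonicity of \<open>W\<close>.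
\<close>

lemma sum_W_le:
  assumes "m \<le> P" "x \<le> y" "(F ^^ Q) y \<le> x + of_int r"
  shows "(\<Sum>i<m. W ((F ^^ i) y) - W ((F ^^ i) x)) \<le> V"
proof -
  define w where "w = (\<lambda>i. W ((F ^^ i) y))"
  have x_ge: "w (i + Q) - of_int r * V \<le> W ((F ^^ i) x)" for i
  proof -
    have "(F ^^ (i + Q)) y = (F ^^ i) ((F ^^ Q) y)" by (simp add: iter_iter)
    also have "\<dots> \<le> (F ^^ i) (x + of_int r)" using assms by simp
    also have "\<dots> = (F ^^ i) x + of_int r" by (rule iter_add_int)
    finally have "w (i + Q) \<le> W ((F ^^ i) x + of_int r)" unfolding w_def by (rule W_mono)
    then show ?thesis by (simp add: W_add_int)
  qed
  have y_ge: "w i + of_int p * V \<le> w (i + P)" for i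
  proof -
    have "(F ^^ i) y + of_int p \<le> (F ^^ (i + P)) y"
      using right[of "(F ^^ i) y"] by (simp add: iter_iter add.commute)
    then have "W ((F ^^ i) y + of_int p) \<le> w (i + P)" unfolding w_def by (rule W_mono)
    then show ?thesis by (simp add: W_add_int w_def)
  qed
  have "(\<Sum>i<m. W ((F ^^ i) y) - W ((F ^^ i) x)) \<le> (\<Sum>i<P. W ((F ^^ i) y) - W ((F ^^ i) x))"
    using assms by (intro sum_mono2) (auto intro: W_mono)
  also have "\<dots> \<le> (\<Sum>i<P. of_int r * V - (w (i + Q) - w i))"
    using x_ge by (intro sum_mono) (auto simp: w_def algebra_simps)
  also have "\<dots> = (\<Sum>i<P. of_int r * V) - (\<Sum>i<P. w (i + Q) - w i)"
    by (rule sum_subtractf)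
  also have "\<dots> = of_nat P * of_int r * V - (\<Sum>i<Q. w (i + P) - w i)"
    unfolding sum_shift_swap[of w Q P] by simp
  also have "\<dots> \<le> of_nat P * of_int r * V - (\<Sum>i<Q. of_int p * V)"
    using y_ge by (intro diff_left_mono sum_mono) (auto simp: algebra_simps)
  also have "\<dots> = of_int (int P * r - int Q * p) * V"
    by (simp add: algebra_simps)
  finally show ?thesis unfolding det by simp
qed

lemma V_nonneg: "0 \<le> V"
  using W_mono[of 0 1] W_per[of 0] by simp

lemma G_le: "x \<le> G x" "(F ^^ Q) (G x) \<le> x + of_int r"
proof -
  show "x \<le> G x" using right[of x] by (simp add: G_def)
  have "(F ^^ Q) (G x) + of_int p = (F ^^ Q) (G x + of_int p)" by (simp only: iter_add_int)
  also have "\<dots> = (F ^^ (P + Q)) x" by (simp add: G_def iter_iter add.commute)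
  finally show "(F ^^ Q) (G x) \<le> x + of_int r" using left[of x] by simp
qed

text \<open>One \<open>V\<close> pays for moving from \<open>y\<close> to its left neighbour
  \<open>u\<close> on an orbit segment of \<open>x\<close>, two more for moving along the orbit from
  \<open>u\<close> to \<open>x\<close>.\<close>

lemma Phi_P_dist: "\<bar>\<Phi> P y - \<Phi> P x\<bar> \<le> 3 * V"
proof -
  obtain m a where m: "m < P + Q" "(F ^^ m) x + of_int a \<le> y"
    "\<And>m' a'. m' < P + Q \<Longrightarrow> (F ^^ m') x + of_int a' \<le> y \<Longrightarrow> (F ^^ m') x + of_int a' \<le> (F ^^ m) x + of_int a"
    using left_neighbour[of "P + Q" "\<lambda>m. (F ^^ m) x" y] P_pos by auto
  define u where "u = (F ^^ m) x + of_int a"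
  \<comment> \<open>An orbit point to the right of \<open>u\<close> bounds \<open>y\<close>:
    \<open>G u\<close> if \<open>m < Q\<close>, otherwise \<open>v\<close>, which
    \<open>F ^^ Q\<close> sends to \<open>u + r\<close>. Its index is again below
    \<open>P + Q\<close>, so maximality of \<open>u\<close> applies.\<close>
  have Qy: "(F ^^ Q) y \<le> u + of_int r"
  proof (cases "m < Q")
    case True
    have "G u = (F ^^ (m + P)) x + of_int (a - p)"
      unfolding G_def u_def iter_add_int iter_iter by (simp add: add.commute)
    moreover have "u < G u" using right[of u] by (simp add: G_def)
    ultimately have "y < G u"
      using m(3)[of "m + P" "a - p"] True by (force simp: u_def)
    then have "(F ^^ Q) y < (F ^^ Q) (G u)" by simp
    then show ?thesis using G_le(2)[of u] by linarith
  next
    case False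
    define v where "v = (F ^^ (m - Q)) x + of_int (a + r)"
    have Qv: "(F ^^ Q) v = u + of_int r"
      unfolding v_def iter_add_int using False by (simp add: iter_iter u_def)
    have "u < v"
    proof (rule ccontr)
      assume "\<not> u < v"
      then have "(F ^^ Q) v < (F ^^ Q) (G u)" using right[of u] by (simp add: G_def)
      then show False using G_le(2)[of u] Qv by simp
    qed
    then have "y < v" using m(1) m(3)[of "m - Q" "a + r"] by (force simp: u_def v_def)
    then have "(F ^^ Q) y < (F ^^ Q) v" by simp
    then show ?thesis using Qv by linarith
  qed
  have small: "\<bar>\<Phi> i z' - \<Phi> i z\<bar> \<le> V" if "i \<le> P" "z \<le> z'" "(F ^^ Q) z' \<le> z + of_int r" for i z z'
    using Phi_diff[of z z' i] sum_W_le[of i z z'] that by linarith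
  have 1: "\<bar>\<Phi> P y - \<Phi> P u\<bar> \<le> V" using small[of P u y] m Qy by (simp add: u_def)
  have 2: "\<bar>\<Phi> i (G z) - \<Phi> i z\<bar> \<le> V" if "i \<le> P" for i z
    using small[of i z "G z"] that G_le[of z] by auto
  \<comment> \<open>Splitting \<open>\<Phi> (m + P) x\<close> in both orders trades a move by
    \<open>m\<close> iterates for the single step from \<open>x\<close> to
    \<open>G x\<close>.\<close>
  have "\<Phi> P u = \<Phi> P ((F ^^ m) x)" by (simp add: u_def Phi_add_int)
  also have "\<dots> - \<Phi> P x = \<Phi> m ((F ^^ P) x) - \<Phi> m x"
    using Phi_add[of m P x] Phi_add[of P m x] by (simp add: add.commute)
  also have "(F ^^ P) x = G x + of_int p" by (simp add: G_def)
  finally have 3: "\<Phi> P u - \<Phi> P x = \<Phi> m (G x) - \<Phi> m x" by (simp add: Phi_add_int)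
  \<comment> \<open>Since \<open>m < P + Q <= 2 * P\<close>, two blocks of length at most
    \<open>P\<close> suffice.\<close>
  have 4: "\<bar>\<Phi> m (G x) - \<Phi> m x\<bar> \<le> 2 * V"
  proof (cases "m \<le> P")
    case True
    then show ?thesis using 2[of m x] V_nonneg by simp
  next
    case False
    then obtain j where j: "m = P + j" by (metis le_add_diff_inverse nat_le_linear)
    then have "j \<le> P" using m(1) Q_le by simp
    have "(F ^^ P) (G x) = G ((F ^^ P) x)"
      using iter_add_int[of P "G x" p] by (simp add: G_def)
    then show ?thesis
      using 2[of P x] 2[OF \<open>j \<le> P\<close>, of "(F ^^ P) x"] unfolding j Phi_add by simp
  qed
  show ?thesis using 1 3 4 by linarith
qed

lemma ln_ratio: "\<bar>ln (d (G x) / d x) - \<Phi> P x\<bar> \<le> V"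
proof -
  have "(F ^^ P) (G x) - (F ^^ P) x = d (G x)" by (simp add: d_def G_def)
  then show ?thesis
    using slope_iter[of x "G x" P] sum_W_le[of P x "G x"] G_le[of x] d_pos[of x] by (simp add: d_def)
qed

text \<open>Minimum and maximum of the continuous periodic function \<open>d\<close>. They make the
  logarithm of the step ratio nonnegative at one point and nonpositive at another, in place of the
  classical remark that a circle diffeomorphism has derivative of mean 1.\<close>

lemma d_extrema:
  obtains s t where "d s \<le> d (G s)" "d (G t) \<le> d t"
proof -
  have d_int: "d (x + of_int n) = d x" for x n by (simp add: d_def G_def iter_add_int)
  have "continuous_on {0..1} d"
    unfolding d_def[abs_def] G_def[abs_def]
    using circle_lift.cont[OF circle_lift_funpow, of P] by (intro continuous_intros) (auto intro: continuous_on_subset)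
  then obtain s t where st: "\<forall>x\<in>{0..1}. d s \<le> d x" "\<forall>x\<in>{0..1}. d x \<le> d t"
    using continuous_attains_sup[of "{0..1::real}" d] continuous_attains_inf[of "{0..1::real}" d]
    by auto
  have red: "\<exists>y\<in>{0..1}. d y = d x" for x
  proof
    show "d (x - of_int \<lfloor>x\<rfloor>) = d x" using d_int[of x "- \<lfloor>x\<rfloor>"] by simp
    show "x - of_int \<lfloor>x\<rfloor> \<in> {0..1}" unfolding atLeastAtMost_iff by linarith
  qed
  obtain y z where "y \<in> {0..1}" "d y = d (G s)" "z \<in> {0..1}" "d z = d (G t)"
    using red[of "G s"] red[of "G t"] by blast
  then show thesis using that[of s t] st by metis
qed

text \<open>The extrema bound \<open>\<Phi> P\<close> by \<open>V\<close> from one side each;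
  transport to \<open>x\<close> costs \<open>3 * V\<close>, and returning from
  \<open>\<Phi> P\<close> to the step ratio costs another \<open>V\<close>.\<close>

lemma denjoy: "\<bar>ln (d (G x) / d x)\<bar> \<le> 5 * V"
proof -
  obtain s t where st: "d s \<le> d (G s)" "d (G t) \<le> d t" by (rule d_extrema)
  have "0 \<le> ln (d (G s) / d s)" using st d_pos[of s] by (simp add: ln_ge_zero)
  then have "- V \<le> \<Phi> P s" using ln_ratio[of s] by linarith
  moreover have "ln (d (G t) / d t) \<le> 0" using st d_pos[of t] d_pos[of "G t"] by simp
  then have "\<Phi> P t \<le> V" using ln_ratio[of t] by linarith
  ultimately show ?thesis
    using Phi_P_dist[of s x] Phi_P_dist[of t x] ln_ratio[of x] by linarith
qed

lemma d_G_bounds: "exp (- (5 * V)) * d x \<le> d (G x)" "d (G x) \<le> exp (5 * V) * d x"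
proof -
  have "d (G x) / d x = exp (ln (d (G x) / d x))" using d_pos by simp
  moreover have "exp (- (5 * V)) \<le> exp (ln (d (G x) / d x))" "exp (ln (d (G x) / d x)) \<le> exp (5 * V)"
    using denjoy[of x] by auto
  ultimately have "exp (- (5 * V)) \<le> d (G x) / d x" "d (G x) / d x \<le> exp (5 * V)" by simp_all
  then show "exp (- (5 * V)) * d x \<le> d (G x)" "d (G x) \<le> exp (5 * V) * d x"
    using d_pos[of x] by (simp_all add: field_simps)
qed

end

section \<open>Cumulative variation of the logarithm of the derivative\<close>

lemma total_variation_extend:
  assumes "s \<le> t"
  shows "total_variation a s g + ereal \<bar>g t - g s\<bar> \<le> total_variation a t g"
proof -
  have "ereal (\<Sum>i<n. \<bar>g (\<tau> (Suc i)) - g (\<tau> i)\<bar>) \<le> total_variation a t g - ereal \<bar>g t - g s\<bar>"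
    if \<tau>: "mono_on {0..n} \<tau>" "\<tau> 0 = a" "\<tau> n = s" for n \<tau>
  proof -
    define \<tau>' where "\<tau>' = \<tau>(Suc n := t)"
    have "mono_on {0..Suc n} \<tau>'"
    proof (rule mono_onI)
      fix i j assume ij: "i \<in> {0..Suc n}" "j \<in> {0..Suc n}" "i \<le> j"
      show "\<tau>' i \<le> \<tau>' j"
      proof (cases "j = Suc n \<and> i \<noteq> Suc n")
        case True
        then have "\<tau> i \<le> \<tau> n" using ij \<tau>(1) by (auto intro: mono_onD)
        then show ?thesis using True \<tau>(3) assms by (simp add: \<tau>'_def)
      next
        case False
        then show ?thesis using ij \<tau>(1) by (auto simp: \<tau>'_def intro: mono_onD)
      qed
    qed
    moreover have "\<tau>' 0 = a" "\<tau>' (Suc n) = t" using \<tau> by (auto simp: \<tau>'_def)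
    ultimately have "ereal (\<Sum>i<Suc n. \<bar>g (\<tau>' (Suc i)) - g (\<tau>' i)\<bar>) \<le> total_variation a t g"
      unfolding total_variation_def by (intro SUP_upper2[of "(Suc n, \<tau>')"]) auto
    moreover have "(\<Sum>i<Suc n. \<bar>g (\<tau>' (Suc i)) - g (\<tau>' i)\<bar>)
        = (\<Sum>i<n. \<bar>g (\<tau> (Suc i)) - g (\<tau> i)\<bar>) + \<bar>g t - g s\<bar>"
      using \<tau> by (simp add: \<tau>'_def)
    ultimately show ?thesis by (simp add: ereal_le_minus)
  qed
  then have "total_variation a s g \<le> total_variation a t g - ereal \<bar>g t - g s\<bar>"
    unfolding total_variation_def[of a s] by (intro SUP_least) auto
  then show ?thesis by (simp add: ereal_le_minus)
qed

lemma total_variation_refl: "0 \<le> total_variation a a g"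
  unfolding total_variation_def
  by (rule SUP_upper2[of "(0, \<lambda>_. a)"]) (auto simp: mono_on_def zero_ereal_def)

lemma finite_variation_majorant:
  assumes "total_variation b (b + 1) g < \<infinity>"
  obtains v where "0 \<le> v b"
    "\<And>s t. b \<le> s \<Longrightarrow> s \<le> t \<Longrightarrow> t \<le> b + 1 \<Longrightarrow> v s + \<bar>g t - g s\<bar> \<le> (v t :: real)"
proof -
  define v where "v = (\<lambda>x. real_of_ereal (total_variation b x g))"
  have fin: "total_variation b x g = ereal (v x)" if "b \<le> x" "x \<le> b + 1" for x
  proof -
    have "0 + 0 \<le> total_variation b b g + ereal \<bar>g x - g b\<bar>"
      by (intro add_mono total_variation_refl) (simp add: zero_ereal_def)
    also have "\<dots> \<le> total_variation b x g" by (rule total_variation_extend) fact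
    finally have "0 \<le> total_variation b x g" by simp
    have "total_variation b x g + 0 \<le> total_variation b x g + ereal \<bar>g (b + 1) - g x\<bar>"
      by (intro add_left_mono) (simp add: zero_ereal_def)
    also have "\<dots> \<le> total_variation b (b + 1) g" by (rule total_variation_extend) fact
    also note assms
    finally have "total_variation b x g < \<infinity>" by simp
    with \<open>0 \<le> total_variation b x g\<close> show ?thesis
      unfolding v_def by (cases "total_variation b x g") auto
  qed
  have 1: "0 \<le> v b" using fin[of b] total_variation_refl[of b g] by simp
  have 2: "v s + \<bar>g t - g s\<bar> \<le> v t" if "b \<le> s" "s \<le> t" "t \<le> b + 1" for s t
    using total_variation_extend[of s t b g] fin[of s] fin[of t] that by simp
  from 1 2 show thesis by (rule that)
qed

text \<open>Here \<open>\<phi>\<close> extends \<open>ln D\<close> periodically from the half-open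
  period, so at break points it takes the value from the right; \<open>W\<close> accumulates its
  variation.\<close>

lemma bv_lift_of_C1:
  assumes F: "circle_lift F"
    and diff: "F differentiable_on {b..b + 1}"
    and D: "\<And>x. D x = vector_derivative F (at x within {b..b + 1})"
    and pos: "\<forall>x\<in>{b..b + 1}. 0 < D x"
    and var: "total_variation b (b + 1) (\<lambda>x. ln (D x)) < \<infinity>"
  obtains \<phi> W V where "bv_lift F \<phi> W V"
proof -
  interpret circle_lift F by (rule F)
  define g where "g = (\<lambda>x. ln (D x))"
  obtain v where v: "0 \<le> v b"
    "\<And>s t. b \<le> s \<Longrightarrow> s \<le> t \<Longrightarrow> t \<le> b + 1 \<Longrightarrow> v s + \<bar>g t - g s\<bar> \<le> (v t :: real)"
    using finite_variation_majorant[of b g] var unfolding g_def by blast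
  \<comment> \<open>The second summand is the jump of \<open>ln D\<close> across the break point,
    which the variation on the closed period does not see.\<close>
  define V where "V = v (b + 1) + \<bar>g (b + 1) - g b\<bar>"
  define N where "N = (\<lambda>x. \<lfloor>x - b\<rfloor>)"
  define \<phi> where "\<phi> = (\<lambda>x. g (x - of_int (N x)))"
  define W where "W = (\<lambda>x. v (x - of_int (N x)) + of_int (N x) * V)"
  have N1: "N (x + 1) = N x + 1" for x unfolding N_def by linarith
  have N_bounds: "b \<le> x - of_int (N x)" "x - of_int (N x) \<le> b + 1" for x
    unfolding N_def by linarith+
  have osc: "\<bar>\<phi> t - \<phi> s\<bar> \<le> W t - W s" if "s \<le> t" for s t
  proof -
    define s' t' where "s' = s - of_int (N s)" and "t' = t - of_int (N t)"
    have b: "b \<le> s'" "s' \<le> b + 1" "b \<le> t'" "t' \<le> b + 1"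
      using N_bounds by (auto simp: s'_def t'_def)
    have "N s \<le> N t" unfolding N_def using that by (intro floor_mono) auto
    show ?thesis
    proof (cases "N s = N t")
      case True
      then have "s' \<le> t'" using that by (simp add: s'_def t'_def)
      then show ?thesis using v(2)[of s' t'] b True by (simp add: \<phi>_def W_def s'_def t'_def)
    next
      case False
      with \<open>N s \<le> N t\<close> have "N s + 1 \<le> N t" by simp
      have V0: "0 \<le> V" using v(1) v(2)[of b "b + 1"] by (simp add: V_def)
      have "1 * V \<le> (of_int (N t) - of_int (N s)) * V"
        using \<open>N s + 1 \<le> N t\<close> V0 by (intro mult_right_mono) linarith+
      moreover have "W t - W s = v t' - v s' + (of_int (N t) - of_int (N s)) * V"
        by (simp add: W_def s'_def t'_def algebra_simps)
      moreover have "\<phi> t - \<phi> s = g t' - g s'" by (simp add: \<phi>_def s'_def t'_def)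
      \<comment> \<open>Go from \<open>s'\<close> to the end of the period, jump to its beginning,
        and continue to \<open>t'\<close>; the term \<open>V\<close> pays for the jump.\<close>
      moreover have "v s' + \<bar>g (b + 1) - g s'\<bar> \<le> v (b + 1)" "v b + \<bar>g t' - g b\<bar> \<le> v t'"
        using v(2) b by auto
      moreover have "V = v (b + 1) + \<bar>g (b + 1) - g b\<bar>" by (fact V_def)
      ultimately show ?thesis using v(1) by linarith
    qed
  qed
  have W_mono: "W s \<le> W t" if "s \<le> t" for s t using osc[OF that] by linarith
  \<comment> \<open>Between consecutive break points the mean value theorem turns the chord slope
    into a value of the derivative, to which \<open>osc\<close> applies.\<close>
  have piece: "\<bar>ln ((F t - F s) / (t - s)) - \<phi> x\<bar> \<le> W y - W x"
    if k: "b + of_int k \<le> s" "s < t" "t \<le> b + of_int k + 1" and xy: "x \<le> s" "t \<le> y" for k s t x y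
  proof -
    define s' t' where "s' = s - of_int k" and "t' = t - of_int k"
    have st: "b \<le> s'" "s' < t'" "t' \<le> b + 1" using k by (auto simp: s'_def t'_def)
    have "continuous_on {s'..t'} F" using cont continuous_on_subset by blast
    moreover have "F differentiable (at z)" if "s' < z" "z < t'" for z
    proof -
      have "b < z" "z < b + 1" using that st by auto
      moreover from this have "F differentiable (at z within {b..b + 1})"
        using diff unfolding differentiable_on_def by auto
      ultimately show ?thesis using at_within_Icc_at[of b z "b + 1"] by simp
    qed
    ultimately obtain l z where z: "s' < z" "z < t'" "DERIV F z :> l" "F t' - F s' = (t' - s') * l"
      using MVT[of s' t' F] st by auto
    have "l = D z"
      using z st at_within_Icc_at[of b z "b + 1"]
      by (simp add: D vector_derivative_at has_real_derivative_iff_has_vector_derivative)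
    moreover have "F t' - F s' = F t - F s" "t' - s' = t - s"
      using add_int[of t "- k"] add_int[of s "- k"] by (auto simp: s'_def t'_def)
    ultimately have "(F t - F s) / (t - s) = D z" using z st by (simp add: field_simps)
    moreover have "N (z + of_int k) = k" unfolding N_def using z st by linarith
    then have "\<phi> (z + of_int k) = ln (D z)" by (simp add: \<phi>_def g_def)
    moreover have "\<bar>\<phi> (z + of_int k) - \<phi> x\<bar> \<le> W (z + of_int k) - W x"
      using z xy by (intro osc) (simp add: s'_def)
    moreover have "W (z + of_int k) \<le> W y" using z xy by (intro W_mono) (simp add: t'_def)
    ultimately show ?thesis by simp
  qed
  have slope: "\<bar>ln ((F y - F x) / (y - x)) - \<phi> x\<bar> \<le> W y - W x" if "x < y" for x y
  proof -
    \<comment> \<open>Logarithms of slopes do not add up over adjacent intervals, whereas linear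
      bounds for the increments do. The bounds are exponentiated before the pieces are glued at the
      break points.\<close>
    define A B where "A = exp (\<phi> x - (W y - W x))" and "B = exp (\<phi> x + (W y - W x))"
    have chunk: "A * (t - s) \<le> F t - F s \<and> F t - F s \<le> B * (t - s)"
      if "b + of_int k \<le> s" "s \<le> t" "t \<le> b + of_int k + 1" "x \<le> s" "t \<le> y" for k s t
    proof (cases "s = t")
      case False
      then have "s < t" using that by simp
      then have "0 < (F t - F s) / (t - s)" by simp
      then have e: "(F t - F s) / (t - s) = exp (ln ((F t - F s) / (t - s)))" by simp
      have "\<bar>ln ((F t - F s) / (t - s)) - \<phi> x\<bar> \<le> W y - W x" using piece[of k s t x y] that \<open>s < t\<close> by auto
      then have "\<phi> x - (W y - W x) \<le> ln ((F t - F s) / (t - s))"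
        "ln ((F t - F s) / (t - s)) \<le> \<phi> x + (W y - W x)" by linarith+
      then have "A \<le> (F t - F s) / (t - s)" "(F t - F s) / (t - s) \<le> B"
        unfolding A_def B_def by (subst e, simp)+
      then show ?thesis using \<open>s < t\<close> by (simp add: field_simps)
    qed simp
    have chain: "A * (t - x) \<le> F t - F x \<and> F t - F x \<le> B * (t - x)"
      if "x \<le> t" "t \<le> y" "t \<le> b + of_int (N x) + 1 + of_nat n" for n t
      using that
    proof (induction n arbitrary: t)
      case 0
      then show ?case using chunk[of "N x" x t] N_bounds[of x] by simp
    next
      case (Suc n)
      define e where "e = b + of_int (N x) + 1 + of_nat n"
      show ?case
      proof (cases "t \<le> e")
        case True
        then show ?thesis using Suc unfolding e_def by simp
      next
        case False
        have "x \<le> e" using N_bounds[of x] unfolding e_def by linarith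
        have "A * (e - x) \<le> F e - F x \<and> F e - F x \<le> B * (e - x)"
          using Suc.IH[of e] Suc.prems False \<open>x \<le> e\<close> by (simp add: e_def)
        moreover have "A * (t - e) \<le> F t - F e \<and> F t - F e \<le> B * (t - e)"
          using chunk[of "N x + 1 + int n" e t] Suc.prems False \<open>x \<le> e\<close> by (simp add: e_def)
        ultimately show ?thesis by (simp add: algebra_simps)
      qed
    qed
    obtain n :: nat where n: "y - (b + of_int (N x) + 1) \<le> of_nat n" using real_arch_simple by blast
    have "A * (y - x) \<le> F y - F x \<and> F y - F x \<le> B * (y - x)"
      using chain[of y n] that n by simp
    then have AB: "A \<le> (F y - F x) / (y - x)" "(F y - F x) / (y - x) \<le> B"
      using that by (auto simp: field_simps)
    have "0 < A" by (simp add: A_def)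
    then have "ln A \<le> ln ((F y - F x) / (y - x))" "ln ((F y - F x) / (y - x)) \<le> ln B"
      using AB by (subst ln_le_cancel_iff; linarith)+
    then show ?thesis by (simp add: A_def B_def abs_le_iff)
  qed
  have "bv_lift F \<phi> W V"
  proof
    show "\<phi> (x + 1) = \<phi> x" for x by (simp add: \<phi>_def N1)
    show "W (x + 1) = W x + V" for x unfolding W_def N1 by (simp add: algebra_simps)
  qed (fact osc slope)+
  then show thesis by (rule that)
qed

section \<open>Close returns to the orbit of the break point\<close>

locale bounded_type_lift = rotating_lift F \<rho> + bv_lift F \<phi> W V
  for F \<rho> \<phi> W V +
  fixes \<theta> :: real and c :: int and k :: "nat \<Rightarrow> nat" and M :: nat and b :: real
  assumes rho: "\<rho> = \<theta> + of_int c" and cf: "has_cf_expansion \<theta> k" and irr: "\<theta> \<notin> \<rat>"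
    and bounded: "\<forall>i\<ge>1. k i \<le> M"
begin

abbreviation "q \<equiv> cf_denom k"
abbreviation "p \<equiv> cf_num c k"
abbreviation "gap \<equiv> cf_gap \<theta> k"

lemma rho_irr: "\<rho> \<notin> \<rat>"
proof
  assume "\<rho> \<in> \<rat>"
  then have "\<rho> - of_int c \<in> \<rat>" by (intro Rats_diff) auto
  then show False using irr rho by simp
qed

lemma gap_even: "even n \<Longrightarrow> real (q n) * \<rho> - of_int (p n) = gap n"
  and gap_odd: "odd n \<Longrightarrow> of_int (p n) - real (q n) * \<rho> = gap n"
  using cf_gap_eq[OF cf irr, of n c] by (simp_all add: rho)

lemmas gap_pos = cf_gap_pos[OF cf irr]
lemmas gap_Suc_less = cf_gap_Suc_less[OF cf irr]
lemmas q_pos_le = cf_denom_pos_le[OF cf irr]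

lemma q_mono: "m \<le> n \<Longrightarrow> q m \<le> q n"
  by (rule lift_Suc_mono_le) (use q_pos_le in auto)

lemma farey:
  assumes "even n"
  shows "farey_pair (int (q n)) (int (q (Suc n))) (p n) (p (Suc n)) \<rho> (gap n) (gap (Suc n))"
proof
  show "0 < int (q n)" "0 < int (q (Suc n))" using q_pos_le by auto
  show "int (q n) * p (Suc n) - int (q (Suc n)) * p n = 1"
    using cf_unimodular[of k n c] assms by simp
  show "gap n = of_int (int (q n)) * \<rho> - of_int (p n)" using gap_even[OF assms] by simp
  show "gap (Suc n) = of_int (p (Suc n)) - of_int (int (q (Suc n))) * \<rho>"
    using gap_odd[of "Suc n"] assms by simp
qed (rule gap_pos)+

text \<open>For even \<open>n\<close>, \<open>R n\<close> is the lift of \<open>T ^^ q n\<close> with rotation number \<open>gap n > 0\<close>.\<close>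

definition R :: "nat \<Rightarrow> real \<Rightarrow> real" where "R n x = (F ^^ q n) x - of_int (p n)"
definition \<delta> :: "nat \<Rightarrow> real \<Rightarrow> real" where "\<delta> n x = R n x - x"

lemma R_add_int: "R n (x + of_int a) = R n x + of_int a"
  by (simp add: R_def iter_add_int)

lemma R_less_iff [simp]: "R n x < R n y \<longleftrightarrow> x < y"
  and R_le_iff [simp]: "R n x \<le> R n y \<longleftrightarrow> x \<le> y"
  by (simp_all add: R_def)

lemma R_iter: "(R n ^^ s) ((F ^^ m) x) = (F ^^ (m + s * q n)) x + of_int (- (int s * p n))"
proof (induction s)
  case (Suc s)
  have "(R n ^^ Suc s) ((F ^^ m) x) = R n ((F ^^ (m + s * q n)) x) - of_int (int s * p n)"
    using Suc R_add_int[of n "(F ^^ (m + s * q n)) x" "- (int s * p n)"] by simp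
  also have "R n ((F ^^ (m + s * q n)) x) = (F ^^ (m + Suc s * q n)) x - of_int (p n)"
    by (simp add: R_def iter_iter add_ac)
  finally show ?case by (simp add: algebra_simps)
qed simp

lemma R_iter_0: "(R n ^^ s) x = (F ^^ (s * q n)) x + of_int (- (int s * p n))"
  using R_iter[where m = 0] by simp

lemma R_iter_rotation:
  assumes "even n"
  shows "real (s * q n) * \<rho> + of_int (- (int s * p n)) = real s * gap n"
  using gap_even[OF assms] by (simp add: algebra_simps flip: gap_even[OF assms])

lemma R_iter_less:
  assumes "even n" "even N" "real s * gap n < real t * gap N"
  shows "(R n ^^ s) x < (R N ^^ t) x"
  unfolding R_iter_0 using assms by (intro orbit_less) (simp only: R_iter_rotation)

text \<open>\<open>orbit_less\<close> covers only strict inequalities. For equality the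
  contrapositive is used: reversed points would give strictly reversed rotations, by
  irrationality.\<close>

lemma R_iter_le:
  assumes "even n" "even N" "real s * gap n \<le> real t * gap N"
  shows "(R n ^^ s) x \<le> (R N ^^ t) x"
proof (rule ccontr)
  assume "\<not> ?thesis"
  then have "(R N ^^ t) x < (R n ^^ s) x" by simp
  then have "real t * gap N < real s * gap n"
    unfolding R_iter_0
    using orbit_less'[OF _ rho_irr] R_iter_rotation[OF assms(1)] R_iter_rotation[OF assms(2)] by metis
  then show False using assms by simp
qed

lemma R_gt: "even n \<Longrightarrow> x < R n x"
  using R_iter_less[of n n 0 1 x] gap_pos[of n] by simp

lemma delta_pos: "even n \<Longrightarrow> 0 < \<delta> n x"
  using R_gt[of n x] by (simp add: \<delta>_def)

definition E :: real where "E = exp (5 * V)"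

text \<open>The partner of \<open>q N\<close> is the previous denominator, which is not larger. The
  joint move goes left because \<open>gap (N - 1) > gap N\<close>.\<close>

lemma denjoy_pair:
  assumes "even N" "2 \<le> N"
  shows "denjoy_pair F \<phi> W V (q N) (q (N - 1)) (p N) (p (N - 1))"
proof -
  obtain n where N: "N = Suc n" "odd n" using assms by (cases N) auto
  show ?thesis
  proof
    show "int (q N) * p (N - 1) - int (q (N - 1)) * p N = 1"
      using cf_unimodular[of k n c] N by simp
    show "x + of_int (p N) < (F ^^ q N) x" for x
      using R_gt[OF assms(1), of x] by (simp add: R_def)
    have "real (q N + q n) * \<rho> < of_int (p N + p n)"
      using gap_even[OF assms(1)] gap_odd[OF N(2)] gap_Suc_less[of n] N by (simp add: algebra_simps)
    then show "(F ^^ (q N + q (N - 1))) x \<le> x + of_int (p N + p (N - 1))" for x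
      using below_translation[of "q N + q n" "p N + p n" x] N by simp
    show "q (N - 1) \<le> q N" "0 < q N" using q_pos_le q_mono by auto
  qed
qed

lemma E_ge_1: "1 \<le> E"
  using denjoy_pair.V_nonneg[OF denjoy_pair[of 2]] by (simp add: E_def)

lemma delta_ratio:
  assumes "even N" "2 \<le> N"
  shows "\<delta> N x \<le> E * \<delta> N (R N x)" "\<delta> N (R N x) \<le> E * \<delta> N x"
proof -
  interpret D: denjoy_pair F \<phi> W V "q N" "q (N - 1)" "p N" "p (N - 1)"
    by (rule denjoy_pair[OF assms])
  have G: "D.G = R N" by (simp add: fun_eq_iff D.G_def R_def)
  then have d: "D.d = \<delta> N" by (simp add: fun_eq_iff D.d_def \<delta>_def)
  show "\<delta> N x \<le> E * \<delta> N (R N x)" "\<delta> N (R N x) \<le> E * \<delta> N x"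
    using D.d_G_bounds[of x] unfolding G d E_def by (simp_all add: exp_minus field_simps)
qed

lemma delta_ratio_iter:
  assumes "even N" "2 \<le> N"
  shows "\<delta> N x \<le> E ^ s * \<delta> N ((R N ^^ s) x)" "\<delta> N ((R N ^^ s) x) \<le> E ^ s * \<delta> N x"
proof (induction s)
  case (Suc s)
  let ?y = "(R N ^^ s) x"
  have "E ^ s * \<delta> N ?y \<le> E ^ s * (E * \<delta> N (R N ?y))"
    using delta_ratio(1)[OF assms, of ?y] E_ge_1 by (intro mult_left_mono) auto
  then show "\<delta> N x \<le> E ^ Suc s * \<delta> N ((R N ^^ Suc s) x)" using Suc(1) by (simp add: mult_ac)
  have "E * \<delta> N ?y \<le> E * (E ^ s * \<delta> N x)"
    using Suc(2) E_ge_1 by (intro mult_left_mono) auto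
  then show "\<delta> N ((R N ^^ Suc s) x) \<le> E ^ Suc s * \<delta> N x"
    using delta_ratio(2)[OF assms, of ?y] by (simp add: mult_ac)
qed simp_all

lemma R_iter_minus: "(R N ^^ K) x - x = (\<Sum>s<K. \<delta> N ((R N ^^ s) x))"
  using sum_lessThan_telescope[of "\<lambda>s. (R N ^^ s) x" K] by (simp add: \<delta>_def)

text \<open>Any of the \<open>K\<close> steps may serve as the unit. The first one is used at the
  left end of a cell, the last one at the right end.\<close>

lemma R_iter_minus_le:
  assumes "even N" "2 \<le> N" "t < K"
  shows "(R N ^^ K) x - x \<le> real K * E ^ K * \<delta> N ((R N ^^ t) x)"
proof -
  let ?x = "\<lambda>s. (R N ^^ s) x"
  have "\<delta> N (?x s) \<le> E ^ K * \<delta> N (?x t)" if "s < K" for s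
  proof -
    have "\<exists>e\<le>K. \<delta> N (?x s) \<le> E ^ e * \<delta> N (?x t)"
    proof (cases "s \<le> t")
      case True
      then have "?x t = (R N ^^ (t - s)) (?x s)" by (simp add: funpow_add[symmetric, THEN fun_cong, unfolded o_def])
      then show ?thesis using delta_ratio_iter(1)[OF assms(1,2), of "?x s" "t - s"] assms(3)
        by (intro exI[of _ "t - s"]) auto
    next
      case False
      then have "?x s = (R N ^^ (s - t)) (?x t)" by (simp add: funpow_add[symmetric, THEN fun_cong, unfolded o_def])
      then show ?thesis using delta_ratio_iter(2)[OF assms(1,2), of "s - t" "?x t"] that
        by (intro exI[of _ "s - t"]) auto
    qed
    then obtain e where e: "e \<le> K" "\<delta> N (?x s) \<le> E ^ e * \<delta> N (?x t)" by blast
    have "E ^ e \<le> E ^ K" using e(1) E_ge_1 by (rule power_increasing)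
    then have "E ^ e * \<delta> N (?x t) \<le> E ^ K * \<delta> N (?x t)"
      using delta_pos[OF assms(1)] by (intro mult_right_mono) (auto simp: less_imp_le)
    with e(2) show ?thesis by simp
  qed
  then have "(\<Sum>s<K. \<delta> N (?x s)) \<le> (\<Sum>s<K. E ^ K * \<delta> N (?x t))" by (intro sum_mono) auto
  then show ?thesis unfolding R_iter_minus by (simp add: mult_ac)
qed

text \<open>By bounded type, \<open>K\<close> steps of \<open>R (n + 8)\<close> reach at least as far as one step of \<open>R n\<close>.\<close>

definition K :: nat where "K = (M + 1) ^ 8"
definition C :: real where "C = real K * E ^ K"

lemma K_pos: "0 < K"
  by (simp add: K_def)

lemma C_ge_1: "1 \<le> C"
proof -
  have "1 * 1 \<le> real K * E ^ K"
    using K_pos E_ge_1 by (intro mult_mono) (auto intro: one_le_power)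
  then show ?thesis by (simp add: C_def)
qed

lemma R_le_iter: "even n \<Longrightarrow> R n x \<le> (R (n + 8) ^^ K) x"
  using R_iter_le[of n "n + 8" 1 K x] cf_gap_le_power[OF cf irr bounded, of n 8]
  by (simp add: K_def add_ac)

lemma left_part_bound:
  assumes "even n"
  shows "\<delta> n u \<le> C * \<delta> (n + 8) u"
  using R_iter_minus_le[of "n + 8" 0 K u] R_le_iter[OF assms, of u] assms K_pos
  by (simp add: C_def \<delta>_def)

text \<open>Lay \<open>K\<close> steps of level \<open>n + 8\<close> so that the last ends at
  \<open>v\<close>. They start at or before \<open>u\<close>, because \<open>v\<close> is within one
  step of level \<open>n\<close> from \<open>u\<close>, and the last one fits between
  \<open>z\<close> and \<open>v\<close>.\<close>

lemma right_part_bound: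
  assumes "even n" "v \<le> R n u" "R (n + 8) z \<le> v"
  shows "v - u \<le> C * (v - z)"
proof -
  let ?N = "n + 8"
  have "surj (R ?N)"
  proof (rule surjI)
    fix y
    show "R ?N (inv (F ^^ q ?N) (y + of_int (p ?N))) = y"
      using circle_lift.bij[OF circle_lift_funpow] by (simp add: R_def bij_is_surj surj_f_inv_f)
  qed
  then have "surj (R ?N ^^ K)" by (rule surj_fn)
  then obtain x where x: "(R ?N ^^ K) x = v" by (metis surjD)
  obtain t where K: "K = Suc t" using K_pos by (cases K) auto
  define w where "w = (R ?N ^^ t) x"
  have "x \<le> u"
  proof (rule ccontr)
    assume "\<not> x \<le> u"
    then have "R n u < R n x" by simp
    also have "\<dots> \<le> v" using R_le_iter[OF assms(1), of x] x by simp
    finally show False using assms(2) by simp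
  qed
  have Rw: "R ?N w = v" using x K by (simp add: w_def)
  have "R ?N z \<le> R ?N w" using Rw assms by simp
  then have "z \<le> w" by simp
  have "v - x \<le> C * \<delta> ?N w"
    using R_iter_minus_le[of ?N t K x] x K assms unfolding C_def w_def by simp
  also have "\<dots> \<le> C * (v - z)"
    using Rw \<open>z \<le> w\<close> C_ge_1 by (intro mult_left_mono) (auto simp: \<delta>_def)
  finally show ?thesis using \<open>x \<le> u\<close> by simp
qed

section \<open>Decay of the steps, and closeness measured in steps\<close>

lemma R_double_le:
  assumes "even n"
  shows "R (n + 2) (R (n + 2) x) \<le> R n x"
proof -
  have "(R (n + 2) ^^ 2) x \<le> (R n ^^ 1) x"
    using cf_gap_halves[OF cf irr, of n] assms by (intro R_iter_le) auto
  then show ?thesis by (simp add: numeral_2_eq_2)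
qed

lemma R_antimono:
  assumes "even n"
  shows "R (n + 2) x \<le> R n x"
proof -
  have "R (n + 2) x < R (n + 2) (R (n + 2) x)" using assms by (intro R_gt) simp
  also note R_double_le[OF assms]
  finally show ?thesis by simp
qed

text \<open>Two steps of level \<open>n + 2\<close> fit into one of level \<open>n\<close>, and the
  second is at least \<open>1 / E\<close> times the first; hence the contraction factor
  \<open>l\<close>.\<close>

lemma delta_tendsto_0: "(\<lambda>j. \<delta> (2 * j) x) \<longlonglongrightarrow> 0"
proof -
  define l where "l = 1 / (1 + 1 / E)"
  have l: "0 < l" "l < 1" using E_ge_1 by (auto simp: l_def field_simps)
  have step: "\<delta> (2 * Suc j) x \<le> l * \<delta> (2 * j) x" for j
  proof -
    let ?n = "2 * j"
    have "\<delta> (?n + 2) x / E \<le> \<delta> (?n + 2) (R (?n + 2) x)"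
      using delta_ratio(1)[of "?n + 2" x] E_ge_1 by (simp add: field_simps)
    moreover have "\<delta> (?n + 2) x + \<delta> (?n + 2) (R (?n + 2) x) \<le> \<delta> ?n x"
      using R_double_le[of ?n x] by (simp add: \<delta>_def)
    ultimately have "(1 + 1 / E) * \<delta> (?n + 2) x \<le> \<delta> ?n x"
      by (simp add: algebra_simps)
    then have "l * ((1 + 1 / E) * \<delta> (?n + 2) x) \<le> l * \<delta> ?n x"
      using l by (intro mult_left_mono) auto
    moreover have "0 < 1 + 1 / E" using E_ge_1 by (intro add_pos_pos) auto
    then have "l * (1 + 1 / E) = 1" by (simp add: l_def)
    ultimately show ?thesis by (simp add: mult.assoc[symmetric])
  qed
  have le: "\<delta> (2 * j) x \<le> l ^ j * \<delta> 0 x" for j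
  proof (induction j)
    case (Suc j)
    have "l * \<delta> (2 * j) x \<le> l * (l ^ j * \<delta> 0 x)" using Suc l by (intro mult_left_mono) auto
    then show ?case using step[of j] by (simp add: mult_ac)
  qed simp
  have "(\<lambda>j. l ^ j * \<delta> 0 x) \<longlonglongrightarrow> 0 * \<delta> 0 x"
    using l by (intro tendsto_intros LIMSEQ_realpow_zero) auto
  then have lim: "(\<lambda>j. l ^ j * \<delta> 0 x) \<longlonglongrightarrow> 0" by simp
  show ?thesis
    by (rule tendsto_sandwich[OF _ _ tendsto_const lim])
      (use le delta_pos in \<open>auto simp: less_imp_le\<close>)
qed

text \<open>Nearness is expressed through \<open>R N\<close> because \<open>R N\<close> commutes
  with \<open>F\<close>: the relation then moves along orbits without distortion, unlike a bound on
  lengths.\<close>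

definition close :: "nat \<Rightarrow> real \<Rightarrow> real \<Rightarrow> bool" where
  "close N z y \<longleftrightarrow> z < R N y \<and> y < R N z"

lemma R_commute: "R N ((F ^^ m) x) = (F ^^ m) (R N x)"
  using iter_add_int[of m "(F ^^ q N) x" "- p N"] by (simp add: R_def iter_iter add.commute)

lemma close_iter: "close N ((F ^^ m) z) ((F ^^ m) y) \<longleftrightarrow> close N z y"
  by (simp add: close_def R_commute)

lemma close_iter_orbit:
  assumes "close N ((F ^^ j) z) ((F ^^ i) b + of_int a)"
  shows "close N ((F ^^ (j + m)) z) ((F ^^ (i + m)) b + of_int a)"
proof -
  have "close N ((F ^^ m) ((F ^^ j) z)) ((F ^^ m) ((F ^^ i) b + of_int a))"
    using assms by (simp only: close_iter)
  then show ?thesis unfolding iter_add_int iter_iter by (simp only: add.commute[of m])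
qed

lemma close_imp_eq:
  assumes "\<And>s. close (n + 2 * s) z y" "even n"
  shows "z = y"
proof -
  obtain h where n: "n = 2 * h" using assms(2) by blast
  have lim: "(\<lambda>s. \<delta> (2 * s) y + \<delta> (2 * s) z) \<longlonglongrightarrow> 0 + 0"
    by (intro tendsto_add delta_tendsto_0)
  have "\<bar>z - y\<bar> \<le> 0 + 0"
  proof (rule LIMSEQ_le_const[OF lim], intro exI[of _ h] allI impI)
    fix s assume "h \<le> s"
    then have "n + 2 * (s - h) = 2 * s" using n by simp
    then have "close (2 * s) z y" using assms(1)[of "s - h"] by simp
    then show "\<bar>z - y\<bar> \<le> \<delta> (2 * s) y + \<delta> (2 * s) z"
      using delta_pos[of "2 * s" y] delta_pos[of "2 * s" z] unfolding close_def \<delta>_def by auto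
  qed
  then show ?thesis by simp
qed

text \<open>One step leads past \<open>z\<close> from the second orbit point and another past the
  first one, so two steps of rotation \<open>gap N\<close> bound the difference.\<close>

lemma close_less:
  assumes "even N" "close N z ((F ^^ i) x + of_int a)" "close N z ((F ^^ i') x + of_int a')"
  shows "real i * \<rho> + of_int a < real i' * \<rho> + of_int a' + 2 * gap N"
proof -
  have "(F ^^ i) x + of_int a < R N z" "z < R N ((F ^^ i') x + of_int a')"
    using assms by (auto simp: close_def)
  then have "(F ^^ i) x + of_int a < R N (R N ((F ^^ i') x + of_int a'))"
    by (meson R_less_iff less_trans)
  also have "\<dots> = (R N ^^ 2) ((F ^^ i') x) + of_int a'"
    by (simp add: R_add_int numeral_2_eq_2)
  also have "\<dots> = (F ^^ (i' + 2 * q N)) x + of_int (a' - 2 * p N)"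
    unfolding R_iter by simp
  finally have "real i * \<rho> + of_int a < real (i' + 2 * q N) * \<rho> + of_int (a' - 2 * p N)"
    by (rule orbit_less'[OF _ rho_irr])
  then show ?thesis using gap_even[OF assms(1)] by (simp add: algebra_simps)
qed

text \<open>Iterating the first pair \<open>j'\<close> times and the second \<open>j\<close> times
  produces two points of the orbit of \<open>b\<close> close to the same point, to which best
  approximation applies.\<close>

lemma close_consecutive:
  assumes n: "even n"
    and 1: "close (n + 8) ((F ^^ j) z) ((F ^^ i) b + of_int a)" "i < q n + q (n + 1)" "j < q (n + 1)"
    and 2: "close (n + 10) ((F ^^ j') z) ((F ^^ i') b + of_int a')" "i' < q (n + 2) + q (n + 3)" "j' < q (n + 3)"
  shows "i + j' = i' + j \<and> a = a'"
proof -
  interpret fp: farey_pair "int (q (n + 6))" "int (q (Suc (n + 6)))" "p (n + 6)" "p (Suc (n + 6))" \<rho>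
    "gap (n + 6)" "gap (Suc (n + 6))"
    using n by (intro farey) auto
  have anti: "R (n + 10) w \<le> R (n + 8) w" for w
    using R_antimono[of "n + 8" w] n by (simp add: add.commute)
  \<comment> \<open>Steps shrink with the level, so closeness at level \<open>n + 10\<close> is the
    stronger one.\<close>
  have "close (n + 8) ((F ^^ j') z) ((F ^^ i') b + of_int a')"
    using 2(1) anti unfolding close_def by (meson less_le_trans)
  then have c': "close (n + 8) ((F ^^ (j + j')) z) ((F ^^ (i' + j)) b + of_int a')"
    using close_iter_orbit[of _ j' z i' a' j] by (simp add: add.commute)
  have c: "close (n + 8) ((F ^^ (j + j')) z) ((F ^^ (i + j')) b + of_int a)"
    using close_iter_orbit[OF 1(1)] .
  have gap2: "2 * gap (n + 8) \<le> gap (n + 6)"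
    using cf_gap_halves[OF cf irr, of "n + 6"] by (simp add: numeral_eq_Suc)
  define m where "m = int (i + j') - int (i' + j)"
  have "real (i + j') * \<rho> + of_int a < real (i' + j) * \<rho> + of_int a' + 2 * gap (n + 8)"
    "real (i' + j) * \<rho> + of_int a' < real (i + j') * \<rho> + of_int a + 2 * gap (n + 8)"
    using close_less[OF _ c c'] close_less[OF _ c' c] n by auto
  then have small: "\<bar>of_int m * \<rho> + of_int (a - a')\<bar> < gap (n + 6)"
    using gap2 by (simp add: m_def algebra_simps abs_less_iff)
  \<comment> \<open>Both \<open>i + j'\<close> and \<open>i' + j\<close> are below
    \<open>3 * q (n + 3)\<close>, and two doublings give
    \<open>4 * q (n + 3) <= q (n + 7)\<close>.\<close>
  have "q n \<le> q (n + 3)" "q (n + 1) \<le> q (n + 3)" "q (n + 2) \<le> q (n + 3)"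
    by (rule q_mono, simp)+
  moreover have "2 * q (n + 3) \<le> q (n + 5)" "2 * q (n + 5) \<le> q (Suc (n + 6))"
    using cf_denom_double[OF cf irr, of "n + 3"] cf_denom_double[OF cf irr, of "n + 5"]
    by (simp_all add: numeral_eq_Suc)
  ultimately have "\<bar>m\<bar> < int (q (Suc (n + 6)))" using 1(2,3) 2(2,3) unfolding m_def by linarith
  with small have "m = 0 \<and> a - a' = 0" by (intro fp.best_approximation)
  then show ?thesis by (simp add: m_def)
qed

section \<open>Good levels and the cells of the partition on the line\<close>

definition good :: "real \<Rightarrow> nat \<Rightarrow> bool" where
  "good z n \<longleftrightarrow> even n \<and> (\<forall>i<q n + q (n + 1). \<forall>j<q (n + 1). \<forall>a.
     \<not> close (n + 8) ((F ^^ j) z) ((F ^^ i) b + of_int a))"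

text \<open>
  If all large even levels were bad, the orbit point close to \<open>z\<close> would be the same at all of them.
\<close>

lemma infinite_good:
  assumes off: "\<And>m l a. (F ^^ m) z \<noteq> (F ^^ l) b + of_int a"
  shows "infinite {n. good z n}"
proof
  assume "finite {n. good z n}"
  then obtain n1 where n1: "\<And>n. good z n \<Longrightarrow> n < n1"
    using finite_nat_set_iff_bounded by auto
  define n0 where "n0 = 2 * n1"
  have "\<exists>i j a. i < q n + q (n + 1) \<and> j < q (n + 1) \<and>
      close (n + 8) ((F ^^ j) z) ((F ^^ i) b + of_int a)" if "even n" "n0 \<le> n" for n
    using n1[of n] that unfolding good_def n0_def by force
  then have "\<forall>s. \<exists>i j a. i < q (n0 + 2 * s) + q (n0 + 2 * s + 1) \<and> j < q (n0 + 2 * s + 1) \<and>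
      close (n0 + 2 * s + 8) ((F ^^ j) z) ((F ^^ i) b + of_int a)" by (simp add: n0_def)
  then obtain i j a where ija: "\<And>s. i s < q (n0 + 2 * s) + q (n0 + 2 * s + 1)"
    "\<And>s. j s < q (n0 + 2 * s + 1)"
    "\<And>s. close (n0 + 2 * s + 8) ((F ^^ j s) z) ((F ^^ i s) b + of_int (a s))"
    by metis
  have const: "i 0 + j s = i s + j 0 \<and> a s = a 0" for s
  proof (induction s)
    case (Suc s)
    have "i s + j (Suc s) = i (Suc s) + j s \<and> a s = a (Suc s)"
    proof (rule close_consecutive[of "n0 + 2 * s" "j s" z "i s" "a s"])
      show "close (n0 + 2 * s + 10) ((F ^^ j (Suc s)) z) ((F ^^ i (Suc s)) b + of_int (a (Suc s)))"
        "i (Suc s) < q (n0 + 2 * s + 2) + q (n0 + 2 * s + 3)" "j (Suc s) < q (n0 + 2 * s + 3)"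
        using ija[of "Suc s"] by (simp_all add: numeral_eq_Suc)
    qed (use ija in \<open>auto simp: n0_def\<close>)
    then show ?case using Suc by simp
  qed simp
  \<comment> \<open>The differences of \<open>i s\<close> and \<open>j s\<close> are constant but
    possibly negative, so the coincidence is stated after \<open>j 0\<close> iterates of
    \<open>z\<close>.\<close>
  have "(F ^^ j 0) z = (F ^^ i 0) b + of_int (a 0)"
  proof (rule close_imp_eq[of "n0 + 8"])
    fix s
    have "close (n0 + 2 * s + 8) ((F ^^ (j s + j 0)) z) ((F ^^ (i s + j 0)) b + of_int (a s))"
      by (rule close_iter_orbit[OF ija(3)])
    moreover have "(F ^^ (j s + j 0)) z = (F ^^ j s) ((F ^^ j 0) z)" by (simp add: iter_iter)
    moreover have "i s + j 0 = j s + i 0" "a s = a 0" using const[of s] by auto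
    moreover have "(F ^^ (j s + i 0)) b + of_int (a 0) = (F ^^ j s) ((F ^^ i 0) b + of_int (a 0))"
      by (simp add: iter_iter iter_add_int)
    ultimately have "close (n0 + 2 * s + 8) ((F ^^ j 0) z) ((F ^^ i 0) b + of_int (a 0))"
      by (simp only: close_iter)
    then show "close (n0 + 8 + 2 * s) ((F ^^ j 0) z) ((F ^^ i 0) b + of_int (a 0))"
      by (simp add: add_ac)
  qed (simp add: n0_def)
  then show False using off by blast
qed

text \<open>Cells are labelled by the orbit index of their left end. For
  \<open>i >= q (n + 1)\<close> the cell belongs to level \<open>n + 1\<close>, which is odd when
  \<open>n\<close> is even: it lies to the left of its base point, of index
  \<open>i - q (n + 1)\<close>, which is therefore its right end.\<close>

definition right_end :: "nat \<Rightarrow> nat \<Rightarrow> real" where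
  "right_end n i = (if i < q (n + 1) then (F ^^ (i + q n)) b - of_int (p n)
     else (F ^^ (i - q (n + 1))) b + of_int (p (n + 1)))"

text \<open>Right ends have indices in the same range as left ends, so \<open>good\<close> controls
  both ends of every cell.\<close>

lemma right_end_orbit:
  assumes "even n" "i < q n + q (n + 1)"
  obtains m e where "m < q n + q (n + 1)" "right_end n i = (F ^^ m) b + of_int e"
    "real m * \<rho> + of_int e = real i * \<rho> + (if i < q (n + 1) then gap n else gap (n + 1))"
proof (cases "i < q (n + 1)")
  case True
  then show ?thesis
    using that[of "i + q n" "- p n"] gap_even[OF assms(1)] by (simp add: right_end_def algebra_simps)
next
  case False
  moreover have "real (i - q (n + 1)) * \<rho> + of_int (p (n + 1)) = real i * \<rho> + gap (n + 1)"
    using False gap_odd[of "n + 1"] assms(1) by (simp add: of_nat_diff algebra_simps)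
  ultimately show ?thesis
    using that[of "i - q (n + 1)" "p (n + 1)"] assms by (simp add: right_end_def)
qed

lemma gap_less_1: "gap n < 1"
proof (induction n)
  case 0
  then show ?case using has_cf_expansion_bounds[OF cf irr] by (simp add: cf_gap_def)
next
  case (Suc n)
  then show ?case using gap_Suc_less[of n] by simp
qed

lemma right_end_bounds:
  assumes "even n" "i < q n + q (n + 1)"
  shows "(F ^^ i) b < right_end n i" "right_end n i < (F ^^ i) b + 1" "right_end n i \<le> R n ((F ^^ i) b)"
proof -
  obtain m e where me: "right_end n i = (F ^^ m) b + of_int e"
    "real m * \<rho> + of_int e = real i * \<rho> + (if i < q (n + 1) then gap n else gap (n + 1))"
    using right_end_orbit[OF assms] by metis
  show "(F ^^ i) b < right_end n i"
    using orbit_less[of i 0 m e b] me gap_pos[of n] gap_pos[of "n + 1"] by simp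
  show "right_end n i < (F ^^ i) b + 1"
    using orbit_less[of m e i 1 b] me gap_less_1[of n] gap_less_1[of "n + 1"] by simp
  show "right_end n i \<le> R n ((F ^^ i) b)"
  proof (cases "i < q (n + 1)")
    case True
    then show ?thesis by (simp add: right_end_def R_def iter_iter add.commute)
  next
    case False
    have "right_end n i < (F ^^ (i + q n)) b + of_int (- p n)"
      unfolding me(1)
      using me(2) False gap_Suc_less[of n] gap_even[OF assms(1)]
      by (intro orbit_less) (simp add: algebra_simps)
    then show ?thesis by (simp add: R_def iter_iter add.commute)
  qed
qed

text \<open>In rotation coordinates a cell has length \<open>gap n\<close> or
  \<open>gap (n + 1)\<close>, and the possible values of \<open>l - i\<close> are exactly those
  ruled out by \<open>no_return_right\<close> or \<open>no_return_left\<close>.\<close>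

lemma no_orbit_between:
  assumes "even n" "i < q n + q (n + 1)" "l < q n + q (n + 1)"
    "(F ^^ i) b < (F ^^ l) b + of_int a"
  shows "right_end n i \<le> (F ^^ l) b + of_int a"
proof (rule ccontr)
  assume "\<not> ?thesis"
  then have lt: "(F ^^ l) b + of_int a < right_end n i" by simp
  interpret fp: farey_pair "int (q n)" "int (q (Suc n))" "p n" "p (Suc n)" \<rho> "gap n" "gap (Suc n)"
    by (rule farey) fact
  obtain m e where me: "right_end n i = (F ^^ m) b + of_int e"
    "real m * \<rho> + of_int e = real i * \<rho> + (if i < q (n + 1) then gap n else gap (n + 1))"
    using right_end_orbit[OF assms(1,2)] by metis
  have "real i * \<rho> + of_int 0 < real l * \<rho> + of_int a"
    using assms(4) by (intro orbit_less'[OF _ rho_irr]) simp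
  moreover have "real l * \<rho> + of_int a < real m * \<rho> + of_int e"
    using lt me by (intro orbit_less'[OF _ rho_irr]) simp
  ultimately have *: "0 < of_int (int l - int i) * \<rho> + of_int a"
    "of_int (int l - int i) * \<rho> + of_int a < (if i < q (n + 1) then gap n else gap (Suc n))"
    using me(2) unfolding Suc_eq_plus1 by (simp_all add: algebra_simps split: if_splits)
  show False
  proof (cases "i < q (n + 1)")
    case True
    then show False using fp.no_return_right[of "int l - int i" a] * assms by simp
  next
    case False
    then show False using fp.no_return_left[of "int l - int i" a] * assms by simp
  qed
qed

text \<open>Goodness at both ends of the cell keeps a full step of level \<open>n + 8\<close> free
  on either side of the point, and such a step is at least \<open>1 / C\<close> of the cell.\<close>

lemma good_proportions:
  assumes "good z n" "j < q (n + 1)" "i < q n + q (n + 1)"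
    and u: "u = (F ^^ i) b + of_int a" and v: "v = right_end n i + of_int a"
    and z: "u < (F ^^ j) z" "(F ^^ j) z < v"
  shows "v - u \<le> C * ((F ^^ j) z - u)" "v - u \<le> C * (v - (F ^^ j) z)"
proof -
  have n: "even n" "even (n + 8)" using assms(1) by (auto simp: good_def)
  let ?N = "n + 8" and ?z = "(F ^^ j) z"
  have vR: "v \<le> R n u"
    using right_end_bounds(3)[OF n(1) assms(3)] by (simp add: u v R_add_int)
  have "\<not> close ?N ?z u" using assms by (auto simp: good_def)
  then have "R ?N u \<le> ?z" using z R_gt[OF n(2), of ?z] by (auto simp: close_def)
  then have "\<delta> ?N u \<le> ?z - u" by (simp add: \<delta>_def)
  then have "C * \<delta> ?N u \<le> C * (?z - u)" using C_ge_1 by (intro mult_left_mono) auto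
  then show "v - u \<le> C * (?z - u)" using left_part_bound[OF n(1), of u] vR by (simp add: \<delta>_def)
  obtain m e where me: "m < q n + q (n + 1)" "v = (F ^^ m) b + of_int (e + a)"
    using right_end_orbit[OF n(1) assms(3)] v by (metis add.assoc of_int_add)
  have "\<not> close ?N ?z v" unfolding me(2) using assms me(1) by (auto simp: good_def simp del: of_int_add)
  then have "R ?N ?z \<le> v" using z R_gt[OF n(2), of v] by (auto simp: close_def)
  with n(1) vR show "v - u \<le> C * (v - ?z)" by (rule right_part_bound)
qed

lemma partition_cell:
  assumes "even n"
  obtains i a where "i < q n + q (n + 1)" "(F ^^ i) b + of_int a \<le> y" "y < right_end n i + of_int a"
proof -
  obtain i a where ia: "i < q n + q (n + 1)" "(F ^^ i) b + of_int a \<le> y"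
    "\<And>m' a'. m' < q n + q (n + 1) \<Longrightarrow> (F ^^ m') b + of_int a' \<le> y \<Longrightarrow> (F ^^ m') b + of_int a' \<le> (F ^^ i) b + of_int a"
    using left_neighbour[of "q n + q (n + 1)" "\<lambda>m. (F ^^ m) b" y] q_pos_le[of n] by auto
  obtain m e where me: "m < q n + q (n + 1)" "right_end n i = (F ^^ m) b + of_int e"
    using right_end_orbit[OF assms ia(1)] by metis
  have "y < right_end n i + of_int a"
    using ia(3)[OF me(1), of "e + a"] right_end_bounds(1)[OF assms ia(1)] me by force
  with ia show thesis using that by blast
qed

lemma partition_cell_unique:
  assumes "even n" "i < q n + q (n + 1)" "(F ^^ i) b + of_int a \<le> y" "y < right_end n i + of_int a"
    "i' < q n + q (n + 1)" "(F ^^ i') b + of_int a' \<le> y" "y < right_end n i' + of_int a'"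
  shows "i = i' \<and> a = a'"
proof -
  have *: "(F ^^ i') b + of_int a' \<le> (F ^^ i) b + of_int a"
    if "i < q n + q (n + 1)" "y < right_end n i + of_int a" "i' < q n + q (n + 1)" "(F ^^ i') b + of_int a' \<le> y"
    for i a i' a'
  proof (rule ccontr)
    assume "\<not> ?thesis"
    then have "right_end n i \<le> (F ^^ i') b + of_int (a' - a)"
      using no_orbit_between[OF assms(1) that(1,3), of "a' - a"] by simp
    then show False using that by simp
  qed
  have eq: "(F ^^ i') b + of_int a' = (F ^^ i) b + of_int a"
    using *[of i a i' a'] *[of i' a' i a] assms by simp
  have r: "real i' * \<rho> + of_int a' = real i * \<rho> + of_int a"
    using orbit_le[of i' b a' i a] orbit_le[of i b a i' a'] eq by simp
  have "i = i'"
  proof (rule ccontr)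
    assume "i \<noteq> i'"
    then have "\<rho> = of_int (a' - a) / of_int (int i - int i')"
      using r by (simp add: field_simps)
    then show False using rho_irr by (metis Rats_divide Rats_of_int)
  qed
  then show ?thesis using r by simp
qed

end

section \<open>Arcs and dynamical partitions\<close>

lemma circle_of_add_int [simp]: "circle_of (x + of_int n) = circle_of x"
  by (simp add: circle_of_eq_iff)

lemma surj_circle_of: "surj circle_of"
proof (rule surjI)
  show "circle_of (rep_circle w) = w" for w by (rule Quotient3_abs_rep[OF Quotient3_circle])
qed

lemma circle_of_eqE:
  assumes "circle_of x = circle_of y"
  obtains n where "x = y + of_int n"
proof -
  obtain n where "x - y = of_int n" using assms by (auto simp: circle_of_eq_iff elim: Ints_cases)
  then show thesis using that[of n] by simp
qed

lemma continuous_on_circle_of: "continuous_on S circle_of"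
proof -
  have "continuous_on UNIV circle_of"
    by (simp add: continuous_on_open_vimage open_circle_def)
  then show ?thesis by (rule continuous_on_subset) simp
qed

lemma inj_on_circle_of:
  assumes "v < u + 1"
  shows "inj_on circle_of {u..v}"
proof (rule inj_onI)
  fix x y assume xy: "x \<in> {u..v}" "y \<in> {u..v}" "circle_of x = circle_of y"
  then obtain n where n: "x = y + of_int n" by (elim circle_of_eqE)
  then have "of_int n < (1 :: real)" "- 1 < (of_int n :: real)" using xy assms by auto
  then have "n = 0" by linarith
  then show "x = y" using n by simp
qed

lemma right_arc_circle_of:
  assumes "x \<le> y" "y < x + 1"
  shows "right_arc (circle_of x) (circle_of y) = circle_of ` {x..y}"
proof
  show "circle_of ` {x..y} \<subseteq> right_arc (circle_of x) (circle_of y)"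
    unfolding right_arc_def using assms by blast
  show "right_arc (circle_of x) (circle_of y) \<subseteq> circle_of ` {x..y}"
  proof
    fix w assume "w \<in> right_arc (circle_of x) (circle_of y)"
    then obtain a b' t where *: "circle_of a = circle_of x" "circle_of b' = circle_of y"
      "a \<le> b'" "b' < a + 1" "a \<le> t" "t \<le> b'" "w = circle_of t"
      unfolding right_arc_def by auto
    obtain m n where mn: "a = x + of_int m" "b' = y + of_int n"
      using *(1,2) by (auto elim!: circle_of_eqE)
    then have "of_int m - of_int n < (1 :: real)" "of_int n - of_int m < (1 :: real)"
      using * assms by linarith+
    then have "m = n" by linarith
    then have "t + of_int (- m) \<in> {x..y}" using * mn by auto
    moreover have "w = circle_of (t + of_int (- m))" unfolding *(7) by (rule circle_of_add_int[symmetric])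
    ultimately show "w \<in> circle_of ` {x..y}" by blast
  qed
qed

text \<open>\<open>arc_length\<close> looks at the period from 0 to 1. So \<open>S\<close> is cut at
  the only integer it can straddle, and the two pieces are translated by different integers.\<close>

lemma arc_length_circle_of:
  assumes S: "S \<in> sets borel" "S \<subseteq> {u..<u + 1}"
  shows "arc_length (circle_of ` S) = measure lborel S"
proof -
  define n where "n = \<lfloor>u\<rfloor>"
  define A B where "A = S \<inter> {..<of_int n + 1}" and "B = S \<inter> {of_int n + 1..}"
  define A' B' where "A' = (\<lambda>x. - of_int n + x) ` A" and "B' = (\<lambda>x. - of_int n - 1 + x) ` B"
  have n: "of_int n \<le> u" "u < of_int n + 1" unfolding n_def by linarith+
  have sets: "A \<in> sets borel" "B \<in> sets borel" using S by (auto simp: A_def B_def)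
  have transl: "(\<lambda>x. a + x) ` X \<in> sets borel" "measure lborel ((\<lambda>x. a + x) ` X) = measure lborel X"
    if "X \<in> sets borel" for a and X :: "real set"
  proof -
    have "(\<lambda>x. a + x) ` X = (\<lambda>x. x - a) -` X" by force
    then show b: "(\<lambda>x. a + x) ` X \<in> sets borel"
      using measurable_sets_borel[of "\<lambda>x. x - a" borel X] that by simp
    show "measure lborel ((\<lambda>x. a + x) ` X) = measure lborel X"
      using measure_translation[of a X] b that by (simp add: measure_completion)
  qed
  have eq: "{0..<1} \<inter> circle_of -` circle_of ` S = A' \<union> B'"
  proof
    show "A' \<union> B' \<subseteq> {0..<1} \<inter> circle_of -` circle_of ` S"
    proof
      fix y assume "y \<in> A' \<union> B'"
      then obtain x m where xm: "x \<in> S" "y = x + of_int m" "0 \<le> y" "y < 1"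
      proof
        assume "y \<in> A'"
        then show thesis using that[of _ "- n"] S(2) n by (force simp: A'_def A_def)
      next
        assume "y \<in> B'"
        then show thesis using that[of _ "- n - 1"] S(2) n by (force simp: B'_def B_def)
      qed
      then have "circle_of y \<in> circle_of ` S" by simp
      then show "y \<in> {0..<1} \<inter> circle_of -` circle_of ` S" using xm by auto
    qed
    show "{0..<1} \<inter> circle_of -` circle_of ` S \<subseteq> A' \<union> B'"
    proof
      fix y assume y: "y \<in> {0..<1} \<inter> circle_of -` circle_of ` S"
      then obtain x where x: "x \<in> S" "circle_of x = circle_of y" by force
      then obtain m where m: "x = y + of_int m" by (elim circle_of_eqE)
      have "u \<le> x" "x < u + 1" using x(1) S(2) by auto
      then have "of_int n - 1 < (of_int m :: real)" "of_int m < (of_int n + 2 :: real)"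
        using y m n by auto
      then consider "m = n" | "m = n + 1" by linarith
      then show "y \<in> A' \<union> B'"
      proof cases
        case 1
        then have "x \<in> A" "y = - of_int n + x" using x y m by (auto simp: A_def)
        then show ?thesis unfolding A'_def by blast
      next
        case 2
        then have "x \<in> B" "y = - of_int n - 1 + x" using x y m by (auto simp: B_def)
        then show ?thesis unfolding B'_def by blast
      qed
    qed
  qed
  have fin: "emeasure lborel X < \<infinity>" if "X \<subseteq> {u..<u + 1}" for X
    using emeasure_mono[OF that, of lborel] by (simp add: le_less_trans)
  have fin': "emeasure lborel X < \<infinity>" if "X \<subseteq> {0..<1 :: real}" for X
    using emeasure_mono[OF that, of lborel] by (simp add: le_less_trans)
  have "A' \<inter> B' = {}"
  proof -
    have False if "s \<in> A" "t \<in> B" "- of_int n + s = - of_int n - 1 + t" for s t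
    proof -
      have "u \<le> s" "t < u + 1" using that S(2) by (auto simp: A_def B_def)
      then show False using that(3) by linarith
    qed
    then show ?thesis unfolding A'_def B'_def by blast
  qed
  moreover have sub: "A' \<subseteq> {0..<1}" "B' \<subseteq> {0..<1}" using eq by blast+
  moreover have "A' \<in> sets borel" "B' \<in> sets borel"
    unfolding A'_def B'_def by (intro transl sets)+
  ultimately have "measure lborel (A' \<union> B') = measure lborel A' + measure lborel B'"
    using fin'[OF sub(1)] fin'[OF sub(2)] by (intro measure_Union) auto
  also have "\<dots> = measure lborel A + measure lborel B"
    unfolding A'_def B'_def by (simp only: transl(2)[OF sets(1)] transl(2)[OF sets(2)])
  also have "\<dots> = measure lborel (A \<union> B)"
  proof (rule measure_Union[symmetric])
    have "A \<subseteq> {u..<u + 1}" "B \<subseteq> {u..<u + 1}" using S(2) by (auto simp: A_def B_def)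
    then show "emeasure lborel A \<noteq> \<infinity>" "emeasure lborel B \<noteq> \<infinity>" using fin[of A] fin[of B] by auto
  qed (use sets in \<open>auto simp: A_def B_def\<close>)
  also have "A \<union> B = S" by (auto simp: A_def B_def)
  finally show ?thesis by (simp add: arc_length_def eq)
qed

text \<open>A component contains each connected piece that it meets. The third alternative does no
  harm later, since it only makes the component longer.\<close>

lemma component_of_two_connected:
  assumes "connected A" "connected B" "X \<in> components (A \<union> B)"
  shows "X = A \<or> X = B \<or> X = A \<union> B"
proof -
  have "A \<subseteq> X \<or> X \<inter> A = {}" "B \<subseteq> X \<or> X \<inter> B = {}"
    using components_maximal[OF assms(3)] assms by blast+
  moreover have "X \<subseteq> A \<union> B" "X \<noteq> {}"
    using assms(3) in_components_subset in_components_nonempty by auto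
  ultimately show ?thesis by blast
qed

lemma arc_component_length:
  assumes "u < z" "z < v" "v < u + 1" and X: "X \<in> components (circle_of ` {u..v} - {circle_of z})"
  shows "min (z - u) (v - z) \<le> arc_length X"
proof -
  have "circle_of ` {u..v} - {circle_of z} = circle_of ` ({u..v} - {z})"
    using inj_on_image_set_diff[OF inj_on_circle_of[OF assms(3)], of "{u..v}" "{z}"] assms by simp
  also have "{u..v} - {z} = {u..<z} \<union> {z<..v}" using assms by auto
  finally have split: "circle_of ` {u..v} - {circle_of z} = circle_of ` {u..<z} \<union> circle_of ` {z<..v}"
    by (simp add: image_Un)
  have "connected (circle_of ` {u..<z})" "connected (circle_of ` {z<..v})"
    by (auto intro!: connected_continuous_image continuous_on_circle_of)
  then have "X = circle_of ` {u..<z} \<or> X = circle_of ` {z<..v} \<or> X = circle_of ` {u..<z} \<union> circle_of ` {z<..v}"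
    using X unfolding split by (rule component_of_two_connected)
  then obtain S where S: "X = circle_of ` S" "S = {u..<z} \<or> S = {z<..v} \<or> S = {u..<z} \<union> {z<..v}"
    by (metis image_Un)
  have len: "arc_length X = measure lborel S"
    unfolding S(1) using S(2) assms by (intro arc_length_circle_of[of _ u]) auto
  have "measure lborel ({u..<z} \<union> {z<..v}) = measure lborel {u..<z} + measure lborel {z<..v}"
    using assms by (intro measure_Union) auto
  then show ?thesis using len S(2) assms by (auto simp: min_def)
qed

section \<open>Transfer of the cells and proportions to the circle\<close>

context bounded_type_lift
begin

context
  fixes T :: "circle \<Rightarrow> circle"
  assumes lift: "circle_of (F x) = T (circle_of x)"
begin

lemma T_iter: "(T ^^ m) (circle_of x) = circle_of ((F ^^ m) x)"
  by (induction m) (auto simp: lift)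

lemma T_iter_image: "(T ^^ m) ` circle_of ` {x..y} = circle_of ` {(F ^^ m) x..(F ^^ m) y}"
  by (simp add: image_image T_iter flip: circle_lift.image_Icc[OF circle_lift_funpow])

lemma dyn_partition_eq:
  assumes "even n"
  shows "dyn_partition T q (circle_of b) n =
    {circle_of ` {(F ^^ i) b..right_end n i} | i. i < q n + q (n + 1)}"
proof -
  let ?J = "\<lambda>i. circle_of ` {(F ^^ i) b..right_end n i}"
  have qpos: "0 < q n" "0 < q (n + 1)" using q_pos_le by auto
  have base: "base_interval T q (circle_of b) n = ?J 0"
  proof -
    have "(T ^^ q n) (circle_of b) = circle_of (right_end n 0)"
      using circle_of_add_int[of "(F ^^ q n) b" "- p n"] qpos by (simp add: T_iter right_end_def)
    then show ?thesis
      using assms qpos right_end_bounds[OF assms, of 0]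
      by (simp add: base_interval_def right_arc_circle_of)
  qed
  \<comment> \<open>Level \<open>n + 1\<close> is odd, so the arc ends at the break point, and its
    left end carries the index \<open>q (n + 1)\<close>.\<close>
  have base': "base_interval T q (circle_of b) (n + 1) = ?J (q (n + 1))"
  proof -
    have "circle_of b = circle_of (right_end n (q (n + 1)))"
      by (simp add: right_end_def)
    moreover have "base_interval T q (circle_of b) (n + 1)
        = right_arc (circle_of ((F ^^ q (n + 1)) b)) (circle_of b)"
      using assms by (simp add: base_interval_def T_iter)
    ultimately have "base_interval T q (circle_of b) (n + 1)
        = right_arc (circle_of ((F ^^ q (n + 1)) b)) (circle_of (right_end n (q (n + 1))))"
      by simp
    then show ?thesis
      using qpos right_end_bounds[OF assms, of "q (n + 1)"] by (simp add: right_arc_circle_of)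
  qed
  have J: "(T ^^ i) ` ?J 0 = ?J i" if "i < q (n + 1)" for i
  proof -
    have "(F ^^ i) (right_end n 0) = right_end n i"
      using iter_add_int[of i "(F ^^ q n) b" "- p n"] that qpos by (simp add: right_end_def iter_iter)
    then show ?thesis by (simp add: T_iter_image)
  qed
  have J': "(T ^^ j) ` ?J (q (n + 1)) = ?J (j + q (n + 1))" for j
  proof -
    have "(F ^^ j) (right_end n (q (n + 1))) = right_end n (j + q (n + 1))"
      using iter_add_int[of j b "p (n + 1)"] by (simp add: right_end_def)
    then show ?thesis by (simp add: T_iter_image iter_iter)
  qed
  have "dyn_partition T q (circle_of b) n
      = (\<lambda>i. (T ^^ i) ` ?J 0) ` {..<q (n + 1)} \<union> (\<lambda>j. ?J (j + q (n + 1))) ` {..<q n}"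
    unfolding dyn_partition_def base base' J' by auto
  also have "(\<lambda>i. (T ^^ i) ` ?J 0) ` {..<q (n + 1)} = ?J ` {..<q (n + 1)}"
    using J by (intro image_cong) auto
  also have "?J ` {..<q (n + 1)} \<union> (\<lambda>j. ?J (j + q (n + 1))) ` {..<q n}
      = ?J ` ({..<q (n + 1)} \<union> (\<lambda>j. j + q (n + 1)) ` {..<q n})"
    by (simp only: image_Un image_image)
  also have "{..<q (n + 1)} \<union> (\<lambda>j. j + q (n + 1)) ` {..<q n} = {..<q n + q (n + 1)}"
  proof (rule set_eqI)
    fix i
    show "i \<in> {..<q (n + 1)} \<union> (\<lambda>j. j + q (n + 1)) ` {..<q n} \<longleftrightarrow> i \<in> {..<q n + q (n + 1)}"
      by (cases "i < q (n + 1)") (auto intro!: rev_image_eqI[of "i - q (n + 1)"])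
  qed
  finally show ?thesis by (auto simp: image_def)
qed

text \<open>Off the orbit of \<open>b\<close> a point is never an end of a cell, so closed cells may
  be replaced by half-open ones. Uniqueness for the latter makes the \<open>THE\<close> in
  \<open>partition_interval\<close> meaningful.\<close>

lemma partition_interval_eq:
  assumes "even n" and off: "\<And>l a. y \<noteq> (F ^^ l) b + of_int a"
  obtains i a where "i < q n + q (n + 1)" "(F ^^ i) b + of_int a < y" "y < right_end n i + of_int a"
    "partition_interval T q (circle_of b) n (circle_of y)
      = circle_of ` {(F ^^ i) b + of_int a..right_end n i + of_int a}"
proof -
  let ?J = "\<lambda>i. circle_of ` {(F ^^ i) b..right_end n i}"
  obtain i a where ia: "i < q n + q (n + 1)" "(F ^^ i) b + of_int a \<le> y" "y < right_end n i + of_int a"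
    by (rule partition_cell[OF assms(1)])
  have mem: "circle_of y \<in> ?J i"
    using ia circle_of_add_int[of y "- a"] by (intro rev_image_eqI[of "y + of_int (- a)"]) auto
  have unique: "i' = i" if i': "i' < q n + q (n + 1)" "circle_of y \<in> ?J i'" for i'
  proof -
    obtain x where x: "(F ^^ i') b \<le> x" "x \<le> right_end n i'" "circle_of y = circle_of x"
      using i' by auto
    obtain a' where a': "y = x + of_int a'" using x(3) by (elim circle_of_eqE)
    obtain m e where "right_end n i' = (F ^^ m) b + of_int e"
      using right_end_orbit[OF assms(1) i'(1)] by metis
    then have "y \<noteq> right_end n i' + of_int a'" using off[of m "e + a'"] by simp
    then have "(F ^^ i') b + of_int a' \<le> y" "y < right_end n i' + of_int a'" using x a' by auto
    then show ?thesis using partition_cell_unique[OF assms(1) ia i'(1)] by simp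
  qed
  have "partition_interval T q (circle_of b) n (circle_of y) = ?J i"
    unfolding partition_interval_def dyn_partition_eq[OF assms(1)]
    using ia(1) mem unique by (intro the_equality) blast+
  also have "\<dots> = circle_of ` (\<lambda>x. x + of_int a) ` {(F ^^ i) b..right_end n i}"
    by (simp only: image_image circle_of_add_int)
  also have "(\<lambda>x. x + of_int a) ` {(F ^^ i) b..right_end n i}
      = {(F ^^ i) b + of_int a..right_end n i + of_int a}"
    by simp
  finally show thesis using that[of i a] ia off[of i a] by force
qed

lemma component_length:
  assumes "good z n" "j < q (n + 1)" and off: "\<And>m l a. (F ^^ m) z \<noteq> (F ^^ l) b + of_int a"
    and X: "X \<in> components (partition_interval T q (circle_of b) n (circle_of ((F ^^ j) z)) - {circle_of ((F ^^ j) z)})"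
  shows "arc_length (partition_interval T q (circle_of b) n (circle_of ((F ^^ j) z))) \<le> C * arc_length X"
proof -
  have n: "even n" using assms(1) by (simp add: good_def)
  let ?z = "(F ^^ j) z"
  obtain i a where ia: "i < q n + q (n + 1)" "(F ^^ i) b + of_int a < ?z" "?z < right_end n i + of_int a"
    "partition_interval T q (circle_of b) n (circle_of ?z)
      = circle_of ` {(F ^^ i) b + of_int a..right_end n i + of_int a}"
    by (rule partition_interval_eq[OF n off])
  define u v where "u = (F ^^ i) b + of_int a" and "v = right_end n i + of_int a"
  have uv: "u < ?z" "?z < v" "v < u + 1"
    using ia right_end_bounds[OF n ia(1)] by (auto simp: u_def v_def)
  have "arc_length (circle_of ` {u..v}) = measure lborel {u..v}"
    using uv by (intro arc_length_circle_of[of _ u]) auto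
  then have "arc_length (circle_of ` {u..v}) = v - u" using uv by simp
  also have "\<dots> \<le> C * min (?z - u) (v - ?z)"
    using good_proportions[OF assms(1,2) ia(1) u_def v_def uv(1,2)] by (simp add: min_def)
  also have "\<dots> \<le> C * arc_length X"
    using arc_component_length[OF uv] X C_ge_1 unfolding ia(4) u_def v_def
    by (intro mult_left_mono) auto
  finally show ?thesis unfolding ia(4) u_def v_def .
qed

end

end

section \<open>From the circle map to its lift, and the universal constant\<close>

theorem proposition4p1:
  fixes T :: "circle \<Rightarrow> circle" and b :: real and x0 :: circle
    and \<rho> :: real and k :: "nat \<Rightarrow> nat" and q :: "nat \<Rightarrow> nat"
  assumes homeo: "orientation_preserving_homeo T"
    and rot: "rotation_number T = \<rho>"
    and irrational: "\<rho> \<notin> \<rat>"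
    and cf: "has_cf_expansion \<rho> k"
    and bounded_type: "\<exists>M. \<forall>i\<ge>1. k i \<le> M"
    and q: "q = cf_denom k"
    and x0: "x0 = circle_of b"
    and C1: "C1_on_period T b"
    and pos: "\<forall>x\<in>{b..b + 1}. 0 < deriv_on_period T b x"
    and jump: "jump_ratio T b \<noteq> 1"
    and var: "total_variation b (b + 1) (\<lambda>x. ln (deriv_on_period T b x)) < \<infinity>"
  shows "\<exists>K1 :: real. 0 < K1 \<and> K1 < 1 \<and>
    (\<forall>z0. full_orbit T z0 \<inter> full_orbit T x0 = {} \<longrightarrow>
      (\<exists>ns :: nat \<Rightarrow> nat. strict_mono ns \<and>
        (\<forall>m. \<forall>j < q (ns m + 1).
          \<forall>C \<in> components (partition_interval T q x0 (ns m) ((T ^^ j) z0) - {(T ^^ j) z0}).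
            K1 * arc_length (partition_interval T q x0 (ns m) ((T ^^ j) z0)) \<le> arc_length C)))"
proof -
  define F where "F = lift T"
  have "is_lift T F"
    unfolding F_def lift_def using homeo someI_ex[of "is_lift T"]
    by (auto simp: orientation_preserving_homeo_def)
  then have F: "circle_lift F" and FT: "\<And>x. circle_of (F x) = T (circle_of x)"
    by (auto simp: is_lift_def circle_lift_def)
  obtain L where L: "(\<lambda>n. (F ^^ n) 0 / real n) \<longlonglongrightarrow> L"
    "\<And>n x. \<bar>(F ^^ n) x - x - real n * L\<bar> \<le> 2"
    using circle_lift.translation_number[OF F] by blast
  have "\<rho> = frac L" using rot limI[OF L(1)] by (simp add: rotation_number_def F_def)
  \<comment> \<open>\<open>lift T\<close> is an arbitrary lift; the integer part of its translation
    number becomes the \<open>c\<close> of the locale.\<close>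
  then have L_eq: "L = \<rho> + of_int \<lfloor>L\<rfloor>" by (simp add: frac_def)
  obtain M where M: "\<forall>i\<ge>1. k i \<le> M" using bounded_type by blast
  obtain \<phi> W V where bv: "bv_lift F \<phi> W V"
  proof (rule bv_lift_of_C1[OF F])
    show "F differentiable_on {b..b + 1}" using C1 by (simp add: C1_on_period_def F_def)
    show "deriv_on_period T b x = vector_derivative F (at x within {b..b + 1})" for x
      by (simp add: deriv_on_period_def F_def)
  qed (use pos var in auto)
  interpret bounded_type_lift F L \<phi> W V \<rho> "\<lfloor>L\<rfloor>" k M b
    by (intro bounded_type_lift.intro rotating_lift.intro rotating_lift_axioms.intro
        bounded_type_lift_axioms.intro F bv L L_eq cf irrational M)
  show ?thesis
  \<comment> \<open>\<open>C\<close> is only known to be at least 1, so the factor 2 makes the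
    constant strictly less than 1. It is fixed before \<open>z0\<close> is introduced.\<close>
  proof (intro exI[of _ "1 / (2 * C)"] conjI allI impI)
    show "0 < 1 / (2 * C)" "1 / (2 * C) < 1" using C_ge_1 by auto
    fix z0 assume disj: "full_orbit T z0 \<inter> full_orbit T x0 = {}"
    obtain z where z: "z0 = circle_of z" by (rule surjE[OF surj_circle_of])
    have off: "(F ^^ m) z \<noteq> (F ^^ l) b + of_int a" for m l a
    proof
      assume "(F ^^ m) z = (F ^^ l) b + of_int a"
      then have "iterate T (int m) z0 = iterate T (int l) x0"
        by (simp add: iterate_def z x0 T_iter[OF FT])
      then show False using disj unfolding full_orbit_def by blast
    qed
    define ns where "ns = enumerate {n. good z n}"
    have inf: "infinite {n. good z n}" using off by (rule infinite_good)
    show "\<exists>ns :: nat \<Rightarrow> nat. strict_mono ns \<and> (\<forall>m. \<forall>j < q (ns m + 1).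
          \<forall>X \<in> components (partition_interval T q x0 (ns m) ((T ^^ j) z0) - {(T ^^ j) z0}).
            1 / (2 * C) * arc_length (partition_interval T q x0 (ns m) ((T ^^ j) z0)) \<le> arc_length X)"
    proof (intro exI[of _ ns] conjI allI impI ballI)
      show "strict_mono ns" unfolding ns_def using inf by (rule strict_mono_enumerate)
      fix m j X
      assume j: "j < q (ns m + 1)"
        and X: "X \<in> components (partition_interval T q x0 (ns m) ((T ^^ j) z0) - {(T ^^ j) z0})"
      have good: "good z (ns m)" using enumerate_in_set[OF inf, of m] by (simp add: ns_def)
      let ?I = "partition_interval T q x0 (ns m) ((T ^^ j) z0)"
      have "arc_length ?I \<le> C * arc_length X"
        using component_length[OF FT good _ off, of j X] j X
        unfolding z x0 q T_iter[OF FT] by simp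
      moreover have "0 \<le> arc_length ?I" by (simp add: arc_length_def)
      ultimately show "1 / (2 * C) * arc_length ?I \<le> arc_length X"
        using C_ge_1 by (simp add: field_simps)
    qed
  qed
qed

end
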